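(* Let $E$ be a Banach function space with order continuous norm over a probability space $(\Omega,\mathbb{P})$, and let $X$ be a Banach space. For a subset $F$ of $E_X$ the following assertions are equivalent: (1) The set $F$ is relatively compact in $E_X$; (2) The set $F$ is uniformly tight, almost order bounded, and scalarly relatively compact.
   Context: A Banach function space over a $\sigma$-finite measure space $(S,\nu)$ is an order ideal $E$ of $L^0(S,\nu)$ (measurable functions modulo equality $\nu$-almost everywhere, with the almost everywhere order), equipped with a complete lattice norm, i.e. $|f|\le |g|$ a.e., $g\in E$ and $f$ measurable imply $f\in E$ and $\|f\|_E\le\|g\|_E$. A Banach lattice $E$ has order continuous norm if every net in $E$ which decreases to $0$ converges to $0$ in norm. For a Banach function space $E$ over a probability space $(\Omega,\mathbb{P})$ and a Banach space $X$, $E_X$ denotes the space of all strongly $\mathbb{P}$-measurable functions $\phi:\Omega\to X$ (modulo equality $\mathbb{P}$-a.e.) such that the function $\|\phi\|:\omega\mapsto\|\phi(\omega)\|$ belongs to $E$; it is a Banach space under the norm $\|\phi\|_{E_X}:=\big\|\,\|\phi\|\,\big\|_E$. A subset $G$ of a Banach lattice $E$ is almost order bounded if for every $\varepsilon>0$ there is $x_\varepsilon\in E$ with $x_\varepsilon\ge 0$ such that $G\subseteq[-x_\varepsilon,x_\varepsilon]+B(\varepsilon)$, where $[-x_\varepsilon,x_\varepsilon]=\{y\in E:-x_\varepsilon\le y\le x_\varepsilon\}$ and $B(\varepsilon)=\{x\in E:\|x\|<\varepsilon\}$. A set $M$ of Radon probability measures on $X$ is uniformly tight if for every $\varepsilon>0$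 there is a compact set $K\subseteq X$ such that $\mu(K)\ge 1-\varepsilon$ for all $\mu\in M$. The distribution of $\phi\in E_X$ is the Radon probability measure $\mu_\phi$ on $X$ given by $\mu_\phi(B)=\mathbb{P}\{\phi\in B\}$ for Borel $B\subseteq X$ (independent of the choice of representative). A subset $F$ of $E_X$ is called: - almost order bounded, if $\{\|\phi\|:\phi\in F\}$ is almost order bounded in $E$; - scalarly relatively compact, if for every $x^*\in X^*$ the set $\{\langle\phi,x^*\rangle:\phi\in F\}$ is relatively norm compact in $E$ (in the complexification of $E$ if the scalar field of $X$ is $\mathbb{C}$), where $\langle\phi,x^*\rangle$ is the function $\omega\mapsto\langle\phi(\omega),x^*\rangle$; - uniformly tight, if $\{\mu_\phi:\phi\in F\}$ is uniformly tight. *)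

theory Defs
  imports "HOL-Probability.Probability"
begin

section \<open>Strongly measurable functions modulo almost everywhere equality\<close>

definition strongly_measurable :: "'w measure \<Rightarrow> ('w \<Rightarrow> 'x::topological_space) \<Rightarrow> bool" where
  "strongly_measurable M f \<longleftrightarrow>
     (\<exists>s. (\<forall>n. simple_function M (s n)) \<and> (AE \<omega> in M. (\<lambda>n. s n \<omega>) \<longlonglongrightarrow> f \<omega>))"

definition ae_class :: "'w measure \<Rightarrow> ('w \<Rightarrow> 'x::topological_space) \<Rightarrow> ('w \<Rightarrow> 'x) set" where
  "ae_class M f = {g. strongly_measurable M g \<and> (AE \<omega> in M. g \<omega> = f \<omega>)}"

text \<open>For real-valued functions, strongly measurable means almost everywhere equal to a Borel
  measurable function, so that \<open>L0 M\<close> at type \<open>real\<close> is the usual space of measurable functions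
  modulo almost everywhere equality.\<close>

definition L0 :: "'w measure \<Rightarrow> ('w \<Rightarrow> 'x::topological_space) set set" where
  "L0 M = ae_class M ` {f. strongly_measurable M f}"

text \<open>Pointwise operations are transferred to classes by means of representatives; for elements
  of \<open>L0 M\<close> and continuous \<open>h\<close> the results do not depend on the choice of representatives.\<close>

definition rep :: "('w \<Rightarrow> 'x) set \<Rightarrow> 'w \<Rightarrow> 'x" where
  "rep A = (SOME f. f \<in> A)"

definition lift1 :: "'w measure \<Rightarrow> ('x::topological_space \<Rightarrow> 'y::topological_space) \<Rightarrow>
    ('w \<Rightarrow> 'x) set \<Rightarrow> ('w \<Rightarrow> 'y) set" where
  "lift1 M h A = ae_class M (\<lambda>\<omega>. h (rep A \<omega>))"

definition lift2 :: "'w measure \<Rightarrow>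
    ('x::topological_space \<Rightarrow> 'y::topological_space \<Rightarrow> 'z::topological_space) \<Rightarrow>
    ('w \<Rightarrow> 'x) set \<Rightarrow> ('w \<Rightarrow> 'y) set \<Rightarrow> ('w \<Rightarrow> 'z) set" where
  "lift2 M h A B = ae_class M (\<lambda>\<omega>. h (rep A \<omega>) (rep B \<omega>))"

definition ae_le :: "'w measure \<Rightarrow> ('w \<Rightarrow> real) set \<Rightarrow> ('w \<Rightarrow> real) set \<Rightarrow> bool" where
  "ae_le M A B \<longleftrightarrow> (AE \<omega> in M. rep A \<omega> \<le> rep B \<omega>)"

definition zero_L0 :: "'w measure \<Rightarrow> ('w \<Rightarrow> 'x::{topological_space,zero}) set" where
  "zero_L0 M = ae_class M (\<lambda>\<omega>. 0)"

section \<open>Banach function spaces\<close>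

text \<open>The locale \<open>Metric_space\<close> requires nonnegativity and symmetry of the distance also outside
  the carrier, where norms are left unspecified; hence the value 0 there.\<close>

definition norm_dist :: "'w measure \<Rightarrow> ('w \<Rightarrow> 'x::real_normed_vector) set set \<Rightarrow>
    (('w \<Rightarrow> 'x) set \<Rightarrow> real) \<Rightarrow> ('w \<Rightarrow> 'x) set \<Rightarrow> ('w \<Rightarrow> 'x) set \<Rightarrow> real" where
  "norm_dist M S n f g = (if f \<in> S \<and> g \<in> S then n (lift2 M (-) f g) else 0)"

locale banach_function_space = sigma_finite_measure M
  for M :: "'w measure" and E :: "('w \<Rightarrow> real) set set" and N :: "('w \<Rightarrow> real) set \<Rightarrow> real" +
  assumes subset_L0: "E \<subseteq> L0 M"
    and zero_mem: "zero_L0 M \<in> E"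
    and add_mem: "\<lbrakk>f \<in> E; g \<in> E\<rbrakk> \<Longrightarrow> lift2 M (+) f g \<in> E"
    and scale_mem: "f \<in> E \<Longrightarrow> lift1 M ((*) c) f \<in> E"
    and ideal: "\<lbrakk>f \<in> L0 M; g \<in> E; ae_le M (lift1 M abs f) (lift1 M abs g)\<rbrakk> \<Longrightarrow> f \<in> E"
    and norm_zero_iff: "f \<in> E \<Longrightarrow> N f = 0 \<longleftrightarrow> f = zero_L0 M"
    and norm_scale: "f \<in> E \<Longrightarrow> N (lift1 M ((*) c) f) = \<bar>c\<bar> * N f"
    and norm_triangle: "\<lbrakk>f \<in> E; g \<in> E\<rbrakk> \<Longrightarrow> N (lift2 M (+) f g) \<le> N f + N g"
    and norm_mono: "\<lbrakk>f \<in> E; g \<in> E; ae_le M (lift1 M abs f) (lift1 M abs g)\<rbrakk> \<Longrightarrow> N f \<le> N g"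
    and complete: "Metric_space.mcomplete E (norm_dist M E N)"

definition directed_preorder :: "'i set \<Rightarrow> ('i \<Rightarrow> 'i \<Rightarrow> bool) \<Rightarrow> bool" where
  "directed_preorder I r \<longleftrightarrow> I \<noteq> {} \<and> (\<forall>i\<in>I. r i i) \<and>
     (\<forall>i\<in>I. \<forall>j\<in>I. \<forall>k\<in>I. r i j \<longrightarrow> r j k \<longrightarrow> r i k) \<and>
     (\<forall>i\<in>I. \<forall>j\<in>I. \<exists>k\<in>I. r i k \<and> r j k)"

definition decreases_to_zero :: "'w measure \<Rightarrow> ('w \<Rightarrow> real) set set \<Rightarrow>
    'i set \<Rightarrow> ('i \<Rightarrow> 'i \<Rightarrow> bool) \<Rightarrow> ('i \<Rightarrow> ('w \<Rightarrow> real) set) \<Rightarrow> bool" where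
  "decreases_to_zero M E I r x \<longleftrightarrow>
     (\<forall>i\<in>I. x i \<in> E) \<and>
     (\<forall>i\<in>I. \<forall>j\<in>I. r i j \<longrightarrow> ae_le M (x j) (x i)) \<and>
     (\<forall>i\<in>I. ae_le M (zero_L0 M) (x i)) \<and>
     (\<forall>z\<in>E. (\<forall>i\<in>I. ae_le M z (x i)) \<longrightarrow> ae_le M z (zero_L0 M))"

text \<open>The index sets range over subsets of the type of elements of \<open>E\<close>. This is no restriction:
  a decreasing net may be reindexed by its range, directed by the reversed order of \<open>E\<close>, without
  affecting its infimum or, the norm being monotone, its convergence to zero.\<close>

definition order_continuous_norm ::
    "'w measure \<Rightarrow> ('w \<Rightarrow> real) set set \<Rightarrow> (('w \<Rightarrow> real) set \<Rightarrow> real) \<Rightarrow> bool" where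
  "order_continuous_norm M E N \<longleftrightarrow>
     (\<forall>(I :: ('w \<Rightarrow> real) set set) r x.
        directed_preorder I r \<longrightarrow> decreases_to_zero M E I r x \<longrightarrow>
        (\<forall>\<epsilon>>0. \<exists>i\<in>I. \<forall>j\<in>I. r i j \<longrightarrow> N (x j) < \<epsilon>))"

definition almost_order_bounded ::
    "'w measure \<Rightarrow> ('w \<Rightarrow> real) set set \<Rightarrow> (('w \<Rightarrow> real) set \<Rightarrow> real) \<Rightarrow> ('w \<Rightarrow> real) set set \<Rightarrow> bool"
    where
  "almost_order_bounded M E N G \<longleftrightarrow>
     (\<forall>\<epsilon>>0. \<exists>x\<in>E. ae_le M (zero_L0 M) x \<and>
        G \<subseteq> {lift2 M (+) y z | y z. y \<in> E \<and> ae_le M (lift1 M uminus x) y \<and> ae_le M y x \<and>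
                                     z \<in> E \<and> N z < \<epsilon>})"

section \<open>Vector-valued spaces\<close>

definition bfs_ext ::
    "'w measure \<Rightarrow> ('w \<Rightarrow> real) set set \<Rightarrow> ('w \<Rightarrow> 'x::real_normed_vector) set set" where
  "bfs_ext M E = {\<phi> \<in> L0 M. lift1 M norm \<phi> \<in> E}"

definition bfs_ext_norm :: "'w measure \<Rightarrow> (('w \<Rightarrow> real) set \<Rightarrow> real) \<Rightarrow>
    ('w \<Rightarrow> 'x::real_normed_vector) set \<Rightarrow> real" where
  "bfs_ext_norm M N \<phi> = N (lift1 M norm \<phi>)"

definition bfs_ext_topology :: "'w measure \<Rightarrow> ('w \<Rightarrow> real) set set \<Rightarrow>
    (('w \<Rightarrow> real) set \<Rightarrow> real) \<Rightarrow> ('w \<Rightarrow> 'x::real_normed_vector) set topology" where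
  "bfs_ext_topology M E N =
     Metric_space.mtopology (bfs_ext M E) (norm_dist M (bfs_ext M E) (bfs_ext_norm M N))"

definition relatively_compact_in :: "'a topology \<Rightarrow> 'a set \<Rightarrow> bool" where
  "relatively_compact_in T F \<longleftrightarrow> F \<subseteq> topspace T \<and> compactin T (T closure_of F)"

definition uniformly_tight :: "'x::topological_space measure set \<Rightarrow> bool" where
  "uniformly_tight P \<longleftrightarrow> (\<forall>\<epsilon>>0. \<exists>K. compact K \<and> (\<forall>\<mu>\<in>P. measure \<mu> K \<ge> 1 - \<epsilon>))"

text \<open>A strongly measurable function is in general only measurable with respect to the completion
  of the underlying measure.\<close>

definition distribution :: "'w measure \<Rightarrow> ('w \<Rightarrow> 'x::topological_space) set \<Rightarrow> 'x measure" where
  "distribution M \<phi> = distr (completion M) borel (rep \<phi>)"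

text \<open>At type \<open>real\<close> the space \<open>bfs_ext M E\<close> is \<open>E\<close> itself with its own norm; at type \<open>complex\<close>
  it is the complexification of \<open>E\<close>, normed by the norm of the modulus. The set \<open>D\<close> below is the
  dual space of \<open>'x\<close> over the scalar field \<open>'k\<close>.\<close>

definition scalarly_relatively_compact :: "'w measure \<Rightarrow> ('w \<Rightarrow> real) set set \<Rightarrow>
    (('w \<Rightarrow> real) set \<Rightarrow> real) \<Rightarrow> ('x::real_normed_vector \<Rightarrow> 'k::real_normed_field) set \<Rightarrow>
    ('w \<Rightarrow> 'x) set set \<Rightarrow> bool" where
  "scalarly_relatively_compact M E N D F \<longleftrightarrow>
     (\<forall>x'\<in>D. relatively_compact_in (bfs_ext_topology M E N) (lift1 M x' ` F))"

definition real_dual :: "('x::real_normed_vector \<Rightarrow> real) set" where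
  "real_dual = {x'. bounded_linear x'}"

text \<open>A complex Banach space is a real Banach space with a compatible complex scalar
  multiplication.\<close>

definition complex_normed_space :: "(complex \<Rightarrow> 'x::real_normed_vector \<Rightarrow> 'x) \<Rightarrow> bool" where
  "complex_normed_space sc \<longleftrightarrow> vector_space sc \<and>
     (\<forall>r x. sc (of_real r) x = r *\<^sub>R x) \<and> (\<forall>c x. norm (sc c x) = cmod c * norm x)"

definition complex_dual ::
    "(complex \<Rightarrow> 'x::real_normed_vector \<Rightarrow> 'x) \<Rightarrow> ('x \<Rightarrow> complex) set" where
  "complex_dual sc = {x'. bounded_linear x' \<and> (\<forall>c x. x' (sc c x) = c * x' x)}"

end

theory Submission
  imports Defs
begin

text \<open>
  The space \<open>bfs_ext M E\<close> is complete (Riesz--Fischer), so relative compactness means total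
  boundedness. Small norm forces small values in measure, hence a finite net in norm gives, for every
  accuracy, a finite set of \<open>'x\<close> that almost carries all distributions; intersecting over the accuracies
  yields tightness. The other two conditions are inherited from finite nets directly.

  Conversely, tightness provides a compact \<open>K\<close> outside of which all functions live on small sets. By
  Hahn--Banach finitely many functionals \<open>f\<close> satisfy \<open>\<parallel>u - v\<parallel> \<le> (\<Sum>f. \<bar>f (u - v)\<bar>) + \<eta>\<close> on \<open>K\<close>. If \<open>x\<close> is an
  approximate order bound, the part of \<open>\<parallel>\<phi> - \<psi>\<parallel>\<close> not controlled by the functionals is therefore dominated
  by \<open>2 min \<eta> x\<close>, by \<open>2 x\<close> on a small set, and by two remainders of small norm; order continuity makes the
  first two small as well. So the distance on \<open>F\<close> is controlled by finitely many scalar distances, each of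
  which has finite nets. (The constant \<open>\<eta>\<close> is truncated to \<open>min \<eta> x\<close> because \<open>E\<close> need not contain
  constants.)
\<close>

section \<open>Norming functionals\<close>

text \<open>Classes are replaced by functions: \<open>Efun\<close> and \<open>nm\<close> express
  membership in \<open>E\<close> and its norm for a function, and most norm estimates come from
  almost everywhere inequalities through \<open>Efun_ideal\<close>. Two mechanisms carry the
  argument. A series of nonnegative functions with norms at most 2^-n has a sum in \<open>E\<close>
  that majorises all partial sums almost everywhere (\<open>E_summable\<close>); this yields both
  the completeness of the vector-valued space and the passage from norm to measure. Order continuity
  enters through sequences decreasing to 0 almost everywhere, namely truncations of \<open>x\<close>
  at heights tending to 0 and restrictions of \<open>x\<close> to shrinking sets. The target space
  may be nonseparable, so measurability of limits and tightness of a single function are drawn from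
  simple functions, whose ranges are finite. A strongly measurable function is Borel only for the
  completed measure, hence probabilities are computed in \<open>completion M\<close>. For complex
  scalars, each real functional is the real part of a complex one, which reduces the complex
  condition to the real one.\<close>

definition sublinear :: "('x::real_vector \<Rightarrow> real) \<Rightarrow> bool" where
  "sublinear p \<longleftrightarrow> (\<forall>x y. p (x + y) \<le> p x + p y) \<and> (\<forall>t>0. \<forall>x. p (t *\<^sub>R x) \<le> t * p x)"

lemma sublinearI:
  assumes "\<And>x y. p (x + y) \<le> p x + p y" "\<And>t x. t > 0 \<Longrightarrow> p (t *\<^sub>R x) \<le> t * p x"
  shows "sublinear p"
  using assms by (auto simp: sublinear_def)

lemma sublinear_add: "sublinear p \<Longrightarrow> p (x + y) \<le> p x + p y"
  by (simp add: sublinear_def)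

lemma sublinear_scale_le: "sublinear p \<Longrightarrow> t > 0 \<Longrightarrow> p (t *\<^sub>R x) \<le> t * p x"
  by (simp add: sublinear_def)

text \<open>The inequality with factor 1/t, applied to t x, is the reverse inequality, so the
  one-sided condition in the definition amounts to positive homogeneity.\<close>

lemma sublinear_scale:
  assumes "sublinear p" "t > 0"
  shows "p (t *\<^sub>R x) = t * p x"
proof -
  have "p (inverse t *\<^sub>R (t *\<^sub>R x)) \<le> inverse t * p (t *\<^sub>R x)"
    using assms by (intro sublinear_scale_le) auto
  then have "t * p x \<le> p (t *\<^sub>R x)"
    using assms by (simp add: field_simps)
  with sublinear_scale_le[OF assms, of x] show ?thesis by simp
qed

lemma sublinear_zero:
  assumes "sublinear p"
  shows "p 0 = 0"
  using sublinear_scale[OF assms, of 2 0] by simp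

lemma sublinear_ge:
  assumes "sublinear p"
  shows "- p (- x) \<le> p x"
  using sublinear_add[OF assms, of x "-x"] sublinear_zero[OF assms] by simp

lemma sublinear_norm: "sublinear norm"
  by (intro sublinearI) (auto intro: norm_triangle_ineq)

text \<open>A minimal sublinear functional coincides with its tilts, hence is linear.\<close>

lemma sublinear_tilt:
  assumes p: "sublinear p"
  obtains q where "sublinear q" "\<And>x. q x \<le> p x" "q (- y) \<le> - p y"
proof -
  \<comment> \<open>The tilt of \<open>p\<close> along \<open>y\<close>: t = 0 gives
    \<open>q \<le> p\<close>, and t = 1 at \<open>- y\<close> gives
    \<open>q (- y) \<le> p 0 - p y = - p y\<close>. The infimum is finite because
    \<open>t * p y = p (t *\<^sub>R y)\<close>, which is at most
    \<open>p (x + t *\<^sub>R y) + p (- x)\<close>.\<close>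
  define q where "q x = (INF t\<in>{0..}. p (x + t *\<^sub>R y) - t * p y)" for x
  have bdd: "bdd_below ((\<lambda>t. p (x + t *\<^sub>R y) - t * p y) ` {0..})" for x
  proof (rule bdd_belowI2)
    fix t :: real assume "t \<in> {0..}"
    then have "p (t *\<^sub>R y) = t * p y"
      using sublinear_scale[OF p, of t y] sublinear_zero[OF p] by (cases "t = 0") auto
    then show "- p (- x) \<le> p (x + t *\<^sub>R y) - t * p y"
      using sublinear_add[OF p, of "x + t *\<^sub>R y" "- x"] by simp
  qed
  have le: "q x \<le> p (x + t *\<^sub>R y) - t * p y" if "t \<ge> 0" for x t
    unfolding q_def using that by (intro cINF_lower[OF bdd]) auto
  have ge: "c \<le> q x" if "\<And>t. t \<ge> 0 \<Longrightarrow> c \<le> p (x + t *\<^sub>R y) - t * p y" for c x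
    unfolding q_def using that by (intro cINF_greatest) auto
  have "sublinear q"
  proof (rule sublinearI)
    fix x z
    \<comment> \<open>Shifts add up: t for \<open>x\<close> and s for \<open>z\<close> give t + s
      for \<open>x + z\<close>. The infima over s and over t are then taken one after the
      other.\<close>
    have "q (x + z) - (p (x + t *\<^sub>R y) - t * p y) \<le> p (z + s *\<^sub>R y) - s * p y"
      if "t \<ge> 0" "s \<ge> 0" for t s
      using le[of "t + s" "x + z"] that sublinear_add[OF p, of "x + t *\<^sub>R y" "z + s *\<^sub>R y"]
      by (simp add: algebra_simps)
    then have "q (x + z) - (p (x + t *\<^sub>R y) - t * p y) \<le> q z" if "t \<ge> 0" for t
      using that by (intro ge)
    then have "q (x + z) - q z \<le> q x"
      by (intro ge) (simp add: algebra_simps)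
    then show "q (x + z) \<le> q x + q z" by simp
  next
    fix t :: real and x assume t: "t > 0"
    have "q (t *\<^sub>R x) / t \<le> p (x + s *\<^sub>R y) - s * p y" if "s \<ge> 0" for s
      using le[of "t * s" "t *\<^sub>R x"] that t sublinear_scale_le[OF p t, of "x + s *\<^sub>R y"]
      by (simp add: field_simps)
    then have "q (t *\<^sub>R x) / t \<le> q x" by (rule ge)
    then show "q (t *\<^sub>R x) \<le> t * q x" using t by (simp add: field_simps)
  qed
  moreover have "q x \<le> p x" for x
    using le[of 0 x] by simp
  moreover have "q (- y) \<le> - p y"
    using le[of 1 "- y"] sublinear_zero[OF p] by simp
  ultimately show thesis by (rule that)
qed

text \<open>Supplies the lower bounds for Zorn's lemma. Two members of a chain have a common smaller
  member, whose own subadditivity gives that of the infimum; the common majorant \<open>p\<close>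
  keeps the infimum above \<open>- p (- x)\<close>.\<close>

lemma chain_Inf_sublinear:
  assumes C: "C \<noteq> {}" and sub: "\<And>q. q \<in> C \<Longrightarrow> sublinear q"
    and le: "\<And>q x. q \<in> C \<Longrightarrow> q x \<le> p x"
    and chain: "\<And>q q'. q \<in> C \<Longrightarrow> q' \<in> C \<Longrightarrow> q \<le> q' \<or> q' \<le> q"
  shows "sublinear (\<lambda>x. INF q\<in>C. q x)" "\<And>q x. q \<in> C \<Longrightarrow> (INF q\<in>C. q x) \<le> q x"
proof -
  define u where "u x = (INF q\<in>C. q x)" for x
  have bdd: "bdd_below ((\<lambda>q. q x) ` C)" for x
  proof (rule bdd_belowI2)
    fix q assume "q \<in> C"
    then show "- p (- x) \<le> q x"
      using sublinear_ge[OF sub, of q x] le[of q "- x"] by simp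
  qed
  have lower: "u x \<le> q x" if "q \<in> C" for q x
    unfolding u_def by (intro cINF_lower[OF bdd that])
  have ge: "c \<le> u x" if "\<And>q. q \<in> C \<Longrightarrow> c \<le> q x" for c x
    unfolding u_def using that C by (intro cINF_greatest)
  have "sublinear u"
  proof (rule sublinearI)
    fix x y
    have "u (x + y) - q x \<le> q' y" if "q \<in> C" "q' \<in> C" for q q'
    proof -
      obtain q0 where "q0 \<in> C" "q0 \<le> q" "q0 \<le> q'"
        using chain[of q q'] \<open>q \<in> C\<close> \<open>q' \<in> C\<close> by auto
      then show ?thesis
        using lower[of q0 "x + y"] sublinear_add[OF sub, of q0 x y] le_funD[of q0 q x]
          le_funD[of q0 q' y] by linarith
    qed
    then have "u (x + y) - q x \<le> u y" if "q \<in> C" for q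
      using that by (intro ge)
    then have "u (x + y) - u y \<le> u x"
      by (intro ge) (simp add: algebra_simps)
    then show "u (x + y) \<le> u x + u y" by simp
  next
    fix t :: real and x assume t: "t > 0"
    have "u (t *\<^sub>R x) / t \<le> q x" if "q \<in> C" for q
      using lower[OF that, of "t *\<^sub>R x"] t sublinear_scale_le[OF sub[OF that] t, of x]
      by (simp add: field_simps)
    then have "u (t *\<^sub>R x) / t \<le> u x" by (rule ge)
    then show "u (t *\<^sub>R x) \<le> t * u x" using t by (simp add: field_simps)
  qed
  then show "sublinear (\<lambda>x. INF q\<in>C. q x)" "\<And>q x. q \<in> C \<Longrightarrow> (INF q\<in>C. q x) \<le> q x"
    using lower by (simp_all add: u_def[abs_def])
qed

text \<open>Hahn--Banach by minimality: a minimal sublinear functional below \<open>p\<close> equals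
  its tilt along every \<open>y\<close>, which makes it odd, and an odd sublinear functional is
  linear.\<close>

lemma linear_below_sublinear:
  fixes p :: "'x::real_vector \<Rightarrow> real"
  assumes p: "sublinear p"
  obtains f where "linear f" "\<And>x. f x \<le> p x"
proof -
  define A where "A = {q. sublinear q \<and> q \<le> p}"
  \<comment> \<open>\<open>predicate_Zorn\<close> yields a maximal element; for the reversed order
    this is a minimal one.\<close>
  let ?P = "\<lambda>a b :: 'x \<Rightarrow> real. b \<le> a"
  have "\<exists>m\<in>A. \<forall>a\<in>A. ?P m a \<longrightarrow> a = m"
  proof (rule predicate_Zorn)
    show "partial_order_on A (relation_of ?P A)"
      by (rule partial_order_on_relation_ofI) auto
    fix C assume "C \<in> Chains (relation_of ?P A)"
    then have C: "C \<subseteq> A" and chain: "\<And>q q'. q \<in> C \<Longrightarrow> q' \<in> C \<Longrightarrow> q \<le> q' \<or> q' \<le> q"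
      by (auto simp: Chains_def relation_of_def)
    show "\<exists>u\<in>A. \<forall>a\<in>C. u \<le> a"
    proof (cases "C = {}")
      case True
      with p show ?thesis by (auto simp: A_def)
    next
      case False
      have C': "sublinear q" "q x \<le> p x" if "q \<in> C" for q x
        using C that by (auto simp: A_def le_fun_def)
      have u: "sublinear (\<lambda>x. INF q\<in>C. q x)" "\<And>q x. q \<in> C \<Longrightarrow> (INF q\<in>C. q x) \<le> q x"
        using chain_Inf_sublinear[of C p] False C' chain by blast+
      have "(\<lambda>x. INF q\<in>C. q x) \<le> p"
      proof (rule le_funI)
        fix x
        from False obtain q where "q \<in> C" by auto
        then show "(INF q\<in>C. q x) \<le> p x"
          using u(2)[of q x] C'(2)[of q x] by simp
      qed
      with u show ?thesis
        by (intro bexI[of _ "\<lambda>x. INF q\<in>C. q x"]) (auto simp: A_def le_fun_def)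
    qed
  qed
  then obtain f where f: "sublinear f" "f \<le> p" and min: "\<And>q. sublinear q \<Longrightarrow> q \<le> f \<Longrightarrow> q = f"
    unfolding A_def by auto
  have neg: "f (- y) = - f y" for y
  proof -
    obtain q where "sublinear q" "\<And>x. q x \<le> f x" "q (- y) \<le> - f y"
      using sublinear_tilt[OF f(1)] by metis
    then have "f (- y) \<le> - f y"
      using min[of q] by (auto simp: le_fun_def)
    then show ?thesis
      using sublinear_ge[OF f(1), of y] by simp
  qed
  \<comment> \<open>The lower estimate is subadditivity for \<open>x = (x + y) + (- y)\<close>
    combined with oddness.\<close>
  have add: "f (x + y) = f x + f y" for x y
    using sublinear_add[OF f(1), of x y] sublinear_add[OF f(1), of "x + y" "- y"] neg[of y] by simp
  have "f (r *\<^sub>R x) = r * f x" for r x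
  proof (cases r "0 :: real" rule: linorder_cases)
    case less
    then show ?thesis
      using sublinear_scale[OF f(1), of "- r" x] neg[of "r *\<^sub>R x"] by simp
  qed (use sublinear_scale[OF f(1)] sublinear_zero[OF f(1)] in auto)
  then have "linear f"
    using add by (intro linearI) auto
  then show thesis
    using f(2) by (intro that) (auto simp: le_fun_def)
qed

text \<open>The norm is tilted along \<open>y\<close> before a linear functional is taken below it.
  Then \<open>f (- y) \<le> - norm y\<close> holds automatically, which takes the place of
  prescribing \<open>f\<close> on the line through \<open>y\<close> and extending.\<close>

lemma norming_functional:
  fixes y :: "'x::real_normed_vector"
  obtains f where "f \<in> real_dual" "\<And>x. \<bar>f x\<bar> \<le> norm x" "f y = norm y"
proof -
  obtain q where q: "sublinear q" "\<And>x. q x \<le> norm x" "q (- y) \<le> - norm y"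
    using sublinear_tilt[OF sublinear_norm] by metis
  obtain f where f: "linear f" "\<And>x. f x \<le> q x"
    using linear_below_sublinear[OF q(1)] by metis
  have neg: "f (- x) = - f x" for x
    using linear_neg[OF f(1)] .
  have le: "f x \<le> norm x" for x
    using f(2) q(2) order_trans by metis
  have abs: "\<bar>f x\<bar> \<le> norm x" for x
    using le[of x] le[of "- x"] neg[of x] by simp
  moreover have "bounded_linear f"
    using f(1) abs by (intro bounded_linear_intro[where K = 1]) (auto simp: linear_add linear_scale)
  moreover have "f y = norm y"
    using le[of y] f(2)[of "- y"] q(3) neg[of y] by simp
  ultimately show thesis
    by (intro that[of f]) (auto simp: real_dual_def)
qed

text \<open>The functionals norm the centres of a finite net of the compact set of differences. One
  half of \<eta> pays for replacing w by its centre y in the norm, the other for replacing w by y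
  inside the functional. A sum rather than a maximum is used because \<open>nm\<close> is
  subadditive.\<close>

lemma compact_norming_functionals:
  fixes K :: "'x::real_normed_vector set"
  assumes K: "compact K" and "\<eta> > 0"
  obtains \<Phi> where "finite \<Phi>" "\<Phi> \<subseteq> real_dual"
    "\<And>u v. u \<in> K \<Longrightarrow> v \<in> K \<Longrightarrow> norm (u - v) \<le> (\<Sum>f\<in>\<Phi>. \<bar>f (u - v)\<bar>) + \<eta>"
proof -
  define D where "D = {u - v |u v. u \<in> K \<and> v \<in> K}"
  have "compact D"
    unfolding D_def using compact_differences[OF K K] by simp
  then obtain Y where Y: "finite Y" "D \<subseteq> (\<Union>y\<in>Y. ball y (\<eta> / 2))"
    using \<open>\<eta> > 0\<close> unfolding compact_eq_totally_bounded by (metis half_gt_zero)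
  define g where "g y = (SOME f. f \<in> real_dual \<and> (\<forall>x. \<bar>f x\<bar> \<le> norm x) \<and> f y = norm y)" for y :: 'x
  have g: "g y \<in> real_dual" "\<And>x. \<bar>g y x\<bar> \<le> norm x" "g y y = norm y" for y
  proof -
    have "\<exists>f. f \<in> real_dual \<and> (\<forall>x. \<bar>f x\<bar> \<le> norm x) \<and> f y = norm y"
      using norming_functional[of y] by metis
    from someI_ex[OF this] show "g y \<in> real_dual" "\<And>x. \<bar>g y x\<bar> \<le> norm x" "g y y = norm y"
      by (auto simp: g_def)
  qed
  show thesis
  proof (rule that[of "g ` Y"])
    fix u v assume "u \<in> K" "v \<in> K"
    define w where "w = u - v"
    have "w \<in> D" using \<open>u \<in> K\<close> \<open>v \<in> K\<close> by (auto simp: D_def w_def)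
    then obtain y where y: "y \<in> Y" "norm (w - y) < \<eta> / 2"
      using Y(2) by (auto simp: dist_norm norm_minus_commute)
    have "g y w = g y (w - y) + norm y"
      using g(1,3)[of y] by (simp add: real_dual_def linear_diff bounded_linear.linear)
    then have "norm w \<le> \<bar>g y w\<bar> + \<eta>"
      using g(2)[of y "w - y"] y(2) norm_triangle_ineq[of "w - y" y] by simp
    also have "\<bar>g y w\<bar> \<le> (\<Sum>f\<in>g ` Y. \<bar>f w\<bar>)"
      using y(1) Y(1) by (intro member_le_sum) auto
    finally show "norm (u - v) \<le> (\<Sum>f\<in>g ` Y. \<bar>f (u - v)\<bar>) + \<eta>"
      by (simp add: w_def)
  qed (use Y g in auto)
qed

section \<open>Strongly measurable functions\<close>

lemma strongly_measurable_simple: "simple_function M f \<Longrightarrow> strongly_measurable M f"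
  unfolding strongly_measurable_def by (intro exI[of _ "\<lambda>_. f"]) auto

lemma strongly_measurable_const [simp]: "strongly_measurable M (\<lambda>_. c)"
  by (intro strongly_measurable_simple) auto

lemma strongly_measurable_AE_cong:
  assumes "strongly_measurable M f" "AE \<omega> in M. f \<omega> = g \<omega>"
  shows "strongly_measurable M g"
proof -
  obtain s where s: "\<And>n. simple_function M (s n)" "AE \<omega> in M. (\<lambda>n. s n \<omega>) \<longlonglongrightarrow> f \<omega>"
    using assms(1) by (auto simp: strongly_measurable_def)
  have "AE \<omega> in M. (\<lambda>n. s n \<omega>) \<longlonglongrightarrow> g \<omega>"
    using s(2) assms(2) by eventually_elim simp
  with s(1) show ?thesis by (auto simp: strongly_measurable_def)
qed

lemma strongly_measurable_compose:
  assumes "strongly_measurable M f" "continuous_on UNIV h"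
  shows "strongly_measurable M (\<lambda>\<omega>. h (f \<omega>))"
proof -
  obtain s where s: "\<And>n. simple_function M (s n)" "AE \<omega> in M. (\<lambda>n. s n \<omega>) \<longlonglongrightarrow> f \<omega>"
    using assms(1) by (auto simp: strongly_measurable_def)
  have "AE \<omega> in M. (\<lambda>n. h (s n \<omega>)) \<longlonglongrightarrow> h (f \<omega>)"
    using s(2) by eventually_elim (rule continuous_on_tendsto_compose[OF assms(2)], auto)
  with s(1) show ?thesis
    unfolding strongly_measurable_def
    by (intro exI[of _ "\<lambda>n \<omega>. h (s n \<omega>)"]) (auto intro: simple_function_compose1)
qed

lemma strongly_measurable_Pair:
  assumes "strongly_measurable M f" "strongly_measurable M g"
  shows "strongly_measurable M (\<lambda>\<omega>. (f \<omega>, g \<omega>))"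
proof -
  obtain s where s: "\<And>n. simple_function M (s n)" "AE \<omega> in M. (\<lambda>n. s n \<omega>) \<longlonglongrightarrow> f \<omega>"
    using assms(1) by (auto simp: strongly_measurable_def)
  obtain t where t: "\<And>n. simple_function M (t n)" "AE \<omega> in M. (\<lambda>n. t n \<omega>) \<longlonglongrightarrow> g \<omega>"
    using assms(2) by (auto simp: strongly_measurable_def)
  have "AE \<omega> in M. (\<lambda>n. (s n \<omega>, t n \<omega>)) \<longlonglongrightarrow> (f \<omega>, g \<omega>)"
    using s(2) t(2) by eventually_elim (rule tendsto_Pair)
  with s(1) t(1) show ?thesis
    unfolding strongly_measurable_def
    by (intro exI[of _ "\<lambda>n \<omega>. (s n \<omega>, t n \<omega>)"]) auto
qed

lemma strongly_measurable_compose2: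
  assumes "strongly_measurable M f" "strongly_measurable M g"
    and "continuous_on UNIV (\<lambda>p. h (fst p) (snd p))"
  shows "strongly_measurable M (\<lambda>\<omega>. h (f \<omega>) (g \<omega>))"
  using strongly_measurable_compose[OF strongly_measurable_Pair[OF assms(1,2)] assms(3)] by simp

lemma strongly_measurable_norm:
  fixes f :: "'w \<Rightarrow> 'x::real_normed_vector"
  shows "strongly_measurable M f \<Longrightarrow> strongly_measurable M (\<lambda>\<omega>. norm (f \<omega>))"
  by (rule strongly_measurable_compose) (auto intro!: continuous_intros)

lemma strongly_measurable_diff:
  fixes f g :: "'w \<Rightarrow> 'x::real_normed_vector"
  shows "strongly_measurable M f \<Longrightarrow> strongly_measurable M g \<Longrightarrow> strongly_measurable M (\<lambda>\<omega>. f \<omega> - g \<omega>)"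
  by (rule strongly_measurable_compose2[where h = "(-)"]) (auto intro!: continuous_intros)

text \<open>Nothing is known about \<open>f\<close> on the null set of divergence, so preimages
  under \<open>f\<close> may meet it in arbitrary subsets; these are measurable only after
  completion.\<close>

lemma strongly_measurable_imp_borel:
  fixes f :: "'w \<Rightarrow> 'x::metric_space"
  assumes "strongly_measurable M f"
  shows "f \<in> borel_measurable (completion M)"
proof -
  obtain s where s: "\<And>n. simple_function M (s n)" "AE \<omega> in M. (\<lambda>n. s n \<omega>) \<longlonglongrightarrow> f \<omega>"
    using assms by (auto simp: strongly_measurable_def)
  obtain Z where Z: "{\<omega>\<in>space M. \<not> (\<lambda>n. s n \<omega>) \<longlonglongrightarrow> f \<omega>} \<subseteq> Z" "Z \<in> null_sets M"
    using s(2) by (auto simp: eventually_ae_filter)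
  have Zs: "Z \<in> sets (completion M)" using Z(2) by auto
  \<comment> \<open>The function and its approximants are made constant on \<open>Z\<close>, which
    turns almost everywhere convergence into convergence everywhere.\<close>
  define g where "g \<omega> = (if \<omega> \<in> Z then undefined else f \<omega>)" for \<omega>
  have "g \<in> borel_measurable (completion M)"
  proof (rule borel_measurable_LIMSEQ_metric)
    show "(\<lambda>\<omega>. if \<omega> \<in> Z then undefined else s n \<omega>) \<in> borel_measurable (completion M)" for n
      using measurable_completion[OF borel_measurable_simple_function[OF s(1)]] Zs
      by (intro measurable_If_set) auto
    show "(\<lambda>n. if \<omega> \<in> Z then undefined else s n \<omega>) \<longlonglongrightarrow> g \<omega>" if "\<omega> \<in> space (completion M)" for \<omega>
      using Z(1) that by (auto simp: g_def)
  qed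
  show ?thesis
  proof (rule measurableI)
    fix B :: "'x set" assume B: "B \<in> sets borel"
    have "f -` B \<inter> Z \<in> sets (completion M)"
      using Z(2) by (intro sets_completionI_sub[of Z]) auto
    moreover have "g -` B \<inter> space (completion M) - Z \<in> sets (completion M)"
      using measurable_sets[OF \<open>g \<in> _\<close> B] Zs by auto
    moreover have "f -` B \<inter> space (completion M) = (f -` B \<inter> Z) \<union> (g -` B \<inter> space (completion M) - Z)"
      using sets.sets_into_space[OF Zs] by (auto simp: g_def)
    ultimately show "f -` B \<inter> space (completion M) \<in> sets (completion M)"
      by auto
  qed auto
qed

lemma borel_imp_strongly_measurable:
  fixes f :: "'w \<Rightarrow> real"
  assumes "f \<in> borel_measurable (completion M)"
  shows "strongly_measurable M f"
proof -
  obtain g where g: "g \<in> borel_measurable M" "AE \<omega> in M. f \<omega> = g \<omega>"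
    using completion_ex_borel_measurable_real[OF assms] by auto
  obtain s where "\<And>n. simple_function M (s n)" "\<And>\<omega>. \<omega> \<in> space M \<Longrightarrow> (\<lambda>n. s n \<omega>) \<longlonglongrightarrow> g \<omega>"
    using borel_measurable_implies_sequence_metric[OF g(1), of 0] by metis
  then have "strongly_measurable M g"
    by (auto simp: strongly_measurable_def intro!: exI[of _ s])
  moreover have "AE \<omega> in M. g \<omega> = f \<omega>"
    using g(2) by eventually_elim simp
  ultimately show ?thesis
    by (rule strongly_measurable_AE_cong)
qed

text \<open>Reduces strong measurability of real sums, minima and products with indicators to the
  standard closure properties of Borel functions.\<close>

lemma strongly_measurable_real_iff:
  "strongly_measurable M (f :: _ \<Rightarrow> real) \<longleftrightarrow> f \<in> borel_measurable (completion M)"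
  using strongly_measurable_imp_borel borel_imp_strongly_measurable by blast

text \<open>An Egorov argument. The exceptional set is built from the simple functions alone and
  hence lies in \<open>sets M\<close> itself, not merely in the completion.\<close>

lemma (in prob_space) strongly_measurable_approx:
  fixes f :: "'a \<Rightarrow> 'x::metric_space"
  assumes "strongly_measurable M f" "e > 0"
  obtains s A where "simple_function M s" "A \<in> sets M" "prob A < e"
    "AE \<omega> in M. \<omega> \<notin> A \<longrightarrow> dist (f \<omega>) (s \<omega>) \<le> e"
proof -
  obtain s where s: "\<And>n. simple_function M (s n)" "AE \<omega> in M. (\<lambda>n. s n \<omega>) \<longlonglongrightarrow> f \<omega>"
    using assms(1) by (auto simp: strongly_measurable_def)
  \<comment> \<open>The points where the sequence from index n on still oscillates by more than e. A
    convergent sequence is Cauchy, so these sets decrease to a null set; off \<open>B n\<close> the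
    oscillation bound passes to the limit.\<close>
  define B where "B n = (\<Union>j\<in>{n..}. \<Union>k\<in>{n..}. {\<omega>\<in>space M. e < dist (s j \<omega>) (s k \<omega>)})" for n
  have d: "simple_function M (\<lambda>\<omega>. dist (s j \<omega>) (s k \<omega>))" for j k
    by (intro simple_function_compose2[where h = dist] s)
  have dm: "{\<omega>\<in>space M. e < dist (s j \<omega>) (s k \<omega>)} \<in> sets M" for j k
    using borel_measurable_simple_function[OF d[of j k]] by measurable
  have Bm: "B n \<in> sets M" for n
    unfolding B_def using dm by (intro sets.countable_UN' countable_Collect) auto
  have "decseq B"
    unfolding decseq_def B_def by fastforce
  have "prob (\<Inter>n. B n) = 0"
  proof (rule prob_eq_0[THEN iffD2])
    show "(\<Inter>n. B n) \<in> events" using Bm by auto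
    show "AE \<omega> in M. \<omega> \<notin> (\<Inter>n. B n)"
      using s(2)
    proof eventually_elim
      case (elim \<omega>)
      then have "Cauchy (\<lambda>n. s n \<omega>)" by (rule LIMSEQ_imp_Cauchy)
      then obtain n where "\<And>j k. j \<ge> n \<Longrightarrow> k \<ge> n \<Longrightarrow> dist (s j \<omega>) (s k \<omega>) < e"
        using assms(2) unfolding Cauchy_def by blast
      then show ?case by (force simp: B_def)
    qed
  qed
  moreover have "(\<lambda>n. prob (B n)) \<longlonglongrightarrow> prob (\<Inter>n. B n)"
    using Bm \<open>decseq B\<close> by (intro finite_Lim_measure_decseq) auto
  ultimately have "\<forall>\<^sub>F n in sequentially. prob (B n) < e"
    using assms(2) by (auto intro: order_tendstoD)
  then obtain n where n: "prob (B n) < e"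
    by (auto simp: eventually_sequentially)
  have "AE \<omega> in M. \<omega> \<notin> B n \<longrightarrow> dist (f \<omega>) (s n \<omega>) \<le> e"
    using s(2) AE_space
  proof eventually_elim
    case (elim \<omega>)
    show ?case
    proof
      assume "\<omega> \<notin> B n"
      with elim have "\<forall>\<^sub>F j in sequentially. dist (s j \<omega>) (s n \<omega>) \<le> e"
        unfolding eventually_sequentially B_def by (intro exI[of _ n]) force
      then show "dist (f \<omega>) (s n \<omega>) \<le> e"
        using tendsto_upperbound[OF tendsto_dist[OF elim(1) tendsto_const]] by force
    qed
  qed
  with s(1) Bm n show thesis by (rule that)
qed

text \<open>The target need not be separable, so Borel measurability does not help; simple functions close
  to \<open>f n\<close> in probability converge almost everywhere to the limit by Borel--Cantelli.\<close>

lemma (in prob_space) strongly_measurable_LIMSEQ: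
  fixes f :: "nat \<Rightarrow> 'a \<Rightarrow> 'x::metric_space"
  assumes f: "\<And>n. strongly_measurable M (f n)" and lim: "AE \<omega> in M. (\<lambda>n. f n \<omega>) \<longlonglongrightarrow> g \<omega>"
  shows "strongly_measurable M g"
proof -
  \<comment> \<open>Simple function and exceptional set are chosen together as a pair. The number
    2^-n is both accuracy and probability bound: it tends to 0 and is summable, as Borel--Cantelli
    demands.\<close>
  have "\<forall>n. \<exists>p. simple_function M (fst p) \<and> snd p \<in> sets M \<and> prob (snd p) < (1/2)^n \<and>
      (AE \<omega> in M. \<omega> \<notin> snd p \<longrightarrow> dist (f n \<omega>) (fst p \<omega>) \<le> (1/2)^n)"
  proof
    fix n
    have "(1/2 :: real)^n > 0" by simp
    from strongly_measurable_approx[OF f[of n] this] obtain s A where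
      "simple_function M s" "A \<in> sets M" "prob A < (1/2)^n"
      "AE \<omega> in M. \<omega> \<notin> A \<longrightarrow> dist (f n \<omega>) (s \<omega>) \<le> (1/2)^n" .
    then show "\<exists>p. simple_function M (fst p) \<and> snd p \<in> sets M \<and> prob (snd p) < (1/2)^n \<and>
        (AE \<omega> in M. \<omega> \<notin> snd p \<longrightarrow> dist (f n \<omega>) (fst p \<omega>) \<le> (1/2)^n)"
      by (intro exI[of _ "(s, A)"]) simp
  qed
  from choice[OF this] obtain p where p: "\<forall>n. simple_function M (fst (p n)) \<and> snd (p n) \<in> sets M \<and>
      prob (snd (p n)) < (1/2)^n \<and>
      (AE \<omega> in M. \<omega> \<notin> snd (p n) \<longrightarrow> dist (f n \<omega>) (fst (p n) \<omega>) \<le> (1/2)^n)" ..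
  define s where "s n = fst (p n)" for n
  define A where "A n = snd (p n)" for n
  have s: "simple_function M (s n)" and A: "A n \<in> sets M" "prob (A n) < (1/2)^n"
    and d: "AE \<omega> in M. \<omega> \<notin> A n \<longrightarrow> dist (f n \<omega>) (s n \<omega>) \<le> (1/2)^n" for n
    using p by (simp_all add: s_def A_def)
  have "summable (\<lambda>n. prob (A n))"
    by (rule summable_comparison_test'[of "\<lambda>n. (1/2)^n" 0]) (use less_imp_le[OF A(2)] in auto)
  then have "AE \<omega> in M. \<forall>\<^sub>F n in sequentially. \<omega> \<in> space M - A n"
    using A(1) by (intro borel_cantelli_AE1) (auto simp: emeasure_eq_measure)
  moreover have "AE \<omega> in M. \<forall>n. \<omega> \<notin> A n \<longrightarrow> dist (f n \<omega>) (s n \<omega>) \<le> (1/2)^n"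
    using d by (simp add: AE_all_countable)
  ultimately have "AE \<omega> in M. (\<lambda>n. s n \<omega>) \<longlonglongrightarrow> g \<omega>"
    using lim
  proof eventually_elim
    case (elim \<omega>)
    have "(\<lambda>n. dist (f n \<omega>) (s n \<omega>)) \<longlonglongrightarrow> 0"
    proof (rule Lim_null_comparison)
      show "\<forall>\<^sub>F n in sequentially. norm (dist (f n \<omega>) (s n \<omega>)) \<le> (1/2)^n"
        using elim(1) by eventually_elim (use elim(2) in auto)
      show "(\<lambda>n. (1/2::real)^n) \<longlonglongrightarrow> 0" by (intro LIMSEQ_power_zero) auto
    qed
    moreover have "(\<lambda>n. dist (f n \<omega>) (g \<omega>)) \<longlonglongrightarrow> 0"
      using tendsto_dist_iff[THEN iffD1, OF elim(3)] .
    ultimately have "(\<lambda>n. dist (f n \<omega>) (s n \<omega>) + dist (f n \<omega>) (g \<omega>)) \<longlonglongrightarrow> 0 + 0"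
      by (rule tendsto_add)
    then have sum: "(\<lambda>n. dist (f n \<omega>) (s n \<omega>) + dist (f n \<omega>) (g \<omega>)) \<longlonglongrightarrow> 0" by simp
    have "(\<lambda>n. dist (s n \<omega>) (g \<omega>)) \<longlonglongrightarrow> 0"
      by (rule Lim_null_comparison[OF _ sum]) (simp add: dist_triangle3)
    then show ?case by (rule tendsto_dist_iff[THEN iffD2])
  qed
  with s show ?thesis by (auto simp: strongly_measurable_def)
qed

section \<open>Almost everywhere classes and their representatives\<close>

lemma ae_class_cong: "AE \<omega> in M. f \<omega> = g \<omega> \<Longrightarrow> ae_class M f = ae_class M g"
proof -
  assume fg: "AE \<omega> in M. f \<omega> = g \<omega>"
  have "(AE \<omega> in M. h \<omega> = f \<omega>) \<longleftrightarrow> (AE \<omega> in M. h \<omega> = g \<omega>)" for h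
    using fg by (auto elim: eventually_elim2)
  then show ?thesis by (simp add: ae_class_def)
qed

text \<open>The class of a function that is not strongly measurable is empty, so equality of classes
  carries information only when \<open>f\<close> belongs to its own class.\<close>

lemma ae_class_eqD:
  assumes "ae_class M f = ae_class M g" "strongly_measurable M f"
  shows "AE \<omega> in M. f \<omega> = g \<omega>"
proof -
  have "f \<in> ae_class M f" using assms(2) by (simp add: ae_class_def)
  with assms(1) show ?thesis by (simp add: ae_class_def)
qed

lemma ae_class_in_L0: "strongly_measurable M f \<Longrightarrow> ae_class M f \<in> L0 M"
  by (simp add: L0_def)

lemma rep_ae_class:
  assumes "strongly_measurable M f"
  shows "AE \<omega> in M. rep (ae_class M f) \<omega> = f \<omega>" "strongly_measurable M (rep (ae_class M f))"
proof -
  have "f \<in> ae_class M f" using assms by (simp add: ae_class_def)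
  then have "rep (ae_class M f) \<in> ae_class M f" unfolding rep_def by (rule someI[of "\<lambda>f. f \<in> _"])
  then show "AE \<omega> in M. rep (ae_class M f) \<omega> = f \<omega>" "strongly_measurable M (rep (ae_class M f))"
    by (auto simp: ae_class_def)
qed

lemma rep_L0:
  assumes "A \<in> L0 M"
  shows "strongly_measurable M (rep A)" "ae_class M (rep A) = A"
proof -
  obtain f where f: "A = ae_class M f" "strongly_measurable M f" using assms by (auto simp: L0_def)
  show "strongly_measurable M (rep A)" using rep_ae_class(2)[OF f(2)] f(1) by simp
  show "ae_class M (rep A) = A" using ae_class_cong[OF rep_ae_class(1)[OF f(2)]] f(1) by simp
qed

lemma lift1_ae_class:
  assumes "strongly_measurable M f"
  shows "lift1 M h (ae_class M f) = ae_class M (\<lambda>\<omega>. h (f \<omega>))"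
  unfolding lift1_def using rep_ae_class(1)[OF assms] by (intro ae_class_cong) (auto elim!: eventually_mono)

lemma lift2_ae_class:
  assumes "strongly_measurable M f" "strongly_measurable M g"
  shows "lift2 M h (ae_class M f) (ae_class M g) = ae_class M (\<lambda>\<omega>. h (f \<omega>) (g \<omega>))"
  unfolding lift2_def using rep_ae_class(1)[OF assms(1)] rep_ae_class(1)[OF assms(2)]
  by (intro ae_class_cong) (auto elim: eventually_elim2)

lemma ae_le_ae_class:
  assumes "strongly_measurable M f" "strongly_measurable M g"
  shows "ae_le M (ae_class M f) (ae_class M g) \<longleftrightarrow> (AE \<omega> in M. f \<omega> \<le> g \<omega>)"
proof -
  have "AE \<omega> in M. (rep (ae_class M f) \<omega> \<le> rep (ae_class M g) \<omega>) = (f \<omega> \<le> g \<omega>)"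
    using rep_ae_class(1)[OF assms(1)] rep_ae_class(1)[OF assms(2)] by eventually_elim simp
  then show ?thesis unfolding ae_le_def by (auto elim: eventually_elim2)
qed

section \<open>Riesz--Fischer theorem\<close>

locale prob_bfs = prob_space M + banach_function_space M E N
  for M :: "'w measure" and E N
begin

text \<open>Functions in place of classes: strong measurability is included so that the class is
  nonempty and has \<open>f\<close> as a possible representative.\<close>

definition Efun :: "('w \<Rightarrow> real) \<Rightarrow> bool" where
  "Efun f \<longleftrightarrow> strongly_measurable M f \<and> ae_class M f \<in> E"

definition nm :: "('w \<Rightarrow> real) \<Rightarrow> real" where
  "nm f = N (ae_class M f)"

lemma EfunD: "Efun f \<Longrightarrow> strongly_measurable M f"
  by (simp add: Efun_def)

lemma Efun_borel: "Efun f \<Longrightarrow> f \<in> borel_measurable (completion M)"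
  by (simp add: Efun_def strongly_measurable_real_iff)

lemma Efun_rep:
  assumes "f \<in> E"
  shows "Efun (rep f)" "N f = nm (rep f)"
  using rep_L0[of f M] subset_L0 assms by (auto simp: Efun_def nm_def)

text \<open>The main tool below: a pointwise bound by a function of \<open>E\<close> gives
  membership and the norm estimate at once.\<close>

lemma Efun_ideal:
  assumes "strongly_measurable M f" "Efun g" "AE \<omega> in M. \<bar>f \<omega>\<bar> \<le> \<bar>g \<omega>\<bar>"
  shows "Efun f" "nm f \<le> nm g"
proof -
  have g: "strongly_measurable M g" "ae_class M g \<in> E" using assms(2) by (auto simp: Efun_def)
  have *: "ae_le M (lift1 M abs (ae_class M f)) (lift1 M abs (ae_class M g))"
    using assms(1,3) g(1) by (simp add: lift1_ae_class ae_le_ae_class strongly_measurable_norm[where 'x = real, simplified])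
  show f: "Efun f"
    using ideal[OF ae_class_in_L0[OF assms(1)] g(2) *] assms(1) by (simp add: Efun_def)
  show "nm f \<le> nm g"
    using norm_mono[OF _ g(2) *] f by (simp add: Efun_def nm_def)
qed

lemma Efun_zero [simp]: "Efun (\<lambda>\<omega>. 0)"
  using zero_mem by (simp add: Efun_def zero_L0_def)

lemma nm_eq_zero_iff:
  assumes "Efun f"
  shows "nm f = 0 \<longleftrightarrow> (AE \<omega> in M. f \<omega> = 0)"
  using norm_zero_iff[of "ae_class M f"] assms ae_class_eqD[of M f "\<lambda>_. 0"] ae_class_cong[of f "\<lambda>_. 0" M]
  by (auto simp: Efun_def nm_def zero_L0_def)

lemma nm_zero [simp]: "nm (\<lambda>\<omega>. 0) = 0"
  by (simp add: nm_eq_zero_iff)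

lemma nm_nonneg: "Efun f \<Longrightarrow> 0 \<le> nm f"
  using Efun_ideal(2)[of "\<lambda>_. 0" f] by simp

lemma Efun_cong:
  assumes "AE \<omega> in M. f \<omega> = g \<omega>"
  shows "nm f = nm g" "Efun f \<Longrightarrow> Efun g"
  using ae_class_cong[OF assms] strongly_measurable_AE_cong[OF _ assms] by (auto simp: nm_def Efun_def)

lemma
  assumes "Efun f" "Efun g"
  shows Efun_add: "Efun (\<lambda>\<omega>. f \<omega> + g \<omega>)" and nm_add: "nm (\<lambda>\<omega>. f \<omega> + g \<omega>) \<le> nm f + nm g"
proof -
  have fg: "strongly_measurable M f" "strongly_measurable M g" using assms by (auto simp: Efun_def)
  have "strongly_measurable M (\<lambda>\<omega>. f \<omega> + g \<omega>)"
    using fg by (simp add: strongly_measurable_real_iff)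
  then show "Efun (\<lambda>\<omega>. f \<omega> + g \<omega>)" "nm (\<lambda>\<omega>. f \<omega> + g \<omega>) \<le> nm f + nm g"
    using assms lift2_ae_class[OF fg, of "(+)"] add_mem[of "ae_class M f" "ae_class M g"]
      norm_triangle[of "ae_class M f" "ae_class M g"]
    by (auto simp: Efun_def nm_def)
qed

lemma
  assumes "Efun f"
  shows Efun_scale: "Efun (\<lambda>\<omega>. c * f \<omega>)" and nm_scale: "nm (\<lambda>\<omega>. c * f \<omega>) = \<bar>c\<bar> * nm f"
proof -
  have f: "strongly_measurable M f" using assms by (auto simp: Efun_def)
  have "strongly_measurable M (\<lambda>\<omega>. c * f \<omega>)"
    using f by (simp add: strongly_measurable_real_iff)
  then show "Efun (\<lambda>\<omega>. c * f \<omega>)" "nm (\<lambda>\<omega>. c * f \<omega>) = \<bar>c\<bar> * nm f"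
    using assms lift1_ae_class[OF f, of "times c"] scale_mem[of "ae_class M f" c]
      norm_scale[of "ae_class M f" c]
    by (auto simp: Efun_def nm_def)
qed

lemma Efun_diff:
  assumes "Efun f" "Efun g"
  shows "Efun (\<lambda>\<omega>. f \<omega> - g \<omega>)"
  using Efun_add[OF assms(1) Efun_scale[OF assms(2), of "-1"]] by simp

lemma nm_minus: "Efun f \<Longrightarrow> nm (\<lambda>\<omega>. - f \<omega>) = nm f"
  using nm_scale[of f "-1"] by simp

lemma Efun_abs:
  assumes "Efun f"
  shows "Efun (\<lambda>\<omega>. \<bar>f \<omega>\<bar>)" "nm (\<lambda>\<omega>. \<bar>f \<omega>\<bar>) = nm f"
proof -
  have "strongly_measurable M (\<lambda>\<omega>. \<bar>f \<omega>\<bar>)"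
    using Efun_borel[OF assms] by (simp add: strongly_measurable_real_iff)
  from Efun_ideal[OF this assms] show *: "Efun (\<lambda>\<omega>. \<bar>f \<omega>\<bar>)" and "nm (\<lambda>\<omega>. \<bar>f \<omega>\<bar>) = nm f"
    using Efun_ideal(2)[of f "\<lambda>\<omega>. \<bar>f \<omega>\<bar>"] EfunD[OF assms] by auto
qed

lemma
  assumes "\<And>i. i \<in> I \<Longrightarrow> Efun (f i)"
  shows Efun_sum: "Efun (\<lambda>\<omega>. \<Sum>i\<in>I. f i \<omega>)" and nm_sum: "nm (\<lambda>\<omega>. \<Sum>i\<in>I. f i \<omega>) \<le> (\<Sum>i\<in>I. nm (f i))"
proof -
  have "Efun (\<lambda>\<omega>. \<Sum>i\<in>I. f i \<omega>) \<and> nm (\<lambda>\<omega>. \<Sum>i\<in>I. f i \<omega>) \<le> (\<Sum>i\<in>I. nm (f i))"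
    using assms
  proof (induction I rule: infinite_finite_induct)
    case (insert i I)
    then show ?case
      using Efun_add[of "f i" "\<lambda>\<omega>. \<Sum>i\<in>I. f i \<omega>"] nm_add[of "f i" "\<lambda>\<omega>. \<Sum>i\<in>I. f i \<omega>"] by simp
  qed auto
  then show "Efun (\<lambda>\<omega>. \<Sum>i\<in>I. f i \<omega>)" "nm (\<lambda>\<omega>. \<Sum>i\<in>I. f i \<omega>) \<le> (\<Sum>i\<in>I. nm (f i))" by auto
qed

section \<open>Completeness of E and almost everywhere majorants\<close>

lemma norm_dist_E:
  assumes "f \<in> E" "g \<in> E"
  shows "norm_dist M E N f g = nm (\<lambda>\<omega>. rep f \<omega> - rep g \<omega>)"
  using assms by (simp add: norm_dist_def nm_def lift2_def)

lemma Metric_space_E: "Metric_space E (norm_dist M E N)"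
proof
  have D: "Efun (\<lambda>\<omega>. rep f \<omega> - rep g \<omega>)" if "f \<in> E" "g \<in> E" for f g
    using Efun_diff Efun_rep(1) that by blast
  fix f g
  show "0 \<le> norm_dist M E N f g"
    using nm_nonneg[OF D[of f g]] norm_dist_E[of f g] by (auto simp: norm_dist_def)
  show "norm_dist M E N f g = norm_dist M E N g f"
    using norm_dist_E[of f g] norm_dist_E[of g f] nm_minus[OF D[of f g]] by (auto simp: norm_dist_def)
next
  fix f g assume fg: "f \<in> E" "g \<in> E"
  have "Efun (\<lambda>\<omega>. rep f \<omega> - rep g \<omega>)"
    using Efun_diff Efun_rep(1) fg by blast
  moreover have "f = g \<longleftrightarrow> (AE \<omega> in M. rep f \<omega> = rep g \<omega>)"
    using rep_L0[of f M] rep_L0[of g M] fg subset_L0 ae_class_cong[of "rep f" "rep g" M] by auto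
  ultimately show "norm_dist M E N f g = 0 \<longleftrightarrow> f = g"
    using fg by (simp add: norm_dist_E nm_eq_zero_iff)
next
  fix f g h assume fg: "f \<in> E" "g \<in> E" "h \<in> E"
  then show "norm_dist M E N f h \<le> norm_dist M E N f g + norm_dist M E N g h"
    using nm_add[of "\<lambda>\<omega>. rep f \<omega> - rep g \<omega>" "\<lambda>\<omega>. rep g \<omega> - rep h \<omega>"]
    by (simp add: norm_dist_E Efun_diff Efun_rep(1))
qed

lemma E_complete:
  assumes f: "\<And>n. Efun (f n)"
    and cauchy: "\<And>e. e > 0 \<Longrightarrow> \<exists>k. \<forall>m\<ge>k. \<forall>n\<ge>k. nm (\<lambda>\<omega>. f m \<omega> - f n \<omega>) < e"
  obtains g where "Efun g" "(\<lambda>n. nm (\<lambda>\<omega>. f n \<omega> - g \<omega>)) \<longlonglongrightarrow> 0"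
proof -
  interpret E: Metric_space E "norm_dist M E N" by (rule Metric_space_E)
  define c where "c n = ae_class M (f n)" for n
  have c: "c n \<in> E" for n using f by (simp add: c_def Efun_def)
  have r: "AE \<omega> in M. rep (c n) \<omega> = f n \<omega>" for n
    unfolding c_def using rep_ae_class(1)[OF EfunD[OF f]] .
  have "norm_dist M E N (c m) (c n) = nm (\<lambda>\<omega>. f m \<omega> - f n \<omega>)" for m n
    unfolding norm_dist_E[OF c c] using r[of m] r[of n] by (intro Efun_cong(1)) (auto elim: eventually_elim2)
  then have "E.MCauchy c"
    unfolding E.MCauchy_def using c cauchy by auto
  then obtain x where "limitin E.mtopology c x sequentially"
    using complete by (auto simp: E.mcomplete_def)
  then have x: "x \<in> E" "(\<lambda>n. norm_dist M E N (c n) x) \<longlonglongrightarrow> 0"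
    by (auto simp: E.limitin_metric_dist_null)
  have "norm_dist M E N (c n) x = nm (\<lambda>\<omega>. f n \<omega> - rep x \<omega>)" for n
    unfolding norm_dist_E[OF c x(1)] using r[of n] by (intro Efun_cong(1)) (auto elim: eventually_mono)
  with x(2) show thesis
    by (intro that[OF Efun_rep(1)[OF x(1)]]) simp
qed

text \<open>Completeness provides a limit in norm, which by itself says nothing pointwise.
  Positivity recovers the pointwise bound: the positive part of \<open>S n - g\<close> is dominated
  by every \<open>\<bar>S m - g\<bar>\<close> with \<open>m \<ge> n\<close>, so its norm vanishes in
  the limit.\<close>

lemma E_summable:
  assumes f: "\<And>n. Efun (f n)" and nonneg: "\<And>n \<omega>. 0 \<le> f n \<omega>" and le: "\<And>n. nm (f n) \<le> (1/2)^n"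
  obtains g where "Efun g" "AE \<omega> in M. \<forall>n. (\<Sum>k<n. f k \<omega>) \<le> g \<omega>"
    "(\<lambda>n. nm (\<lambda>\<omega>. (\<Sum>k<n. f k \<omega>) - g \<omega>)) \<longlonglongrightarrow> 0"
proof -
  define S where "S n \<omega> = (\<Sum>k<n. f k \<omega>)" for n \<omega>
  have S: "Efun (S n)" for n unfolding S_def by (intro Efun_sum f)
  have small: "nm (\<lambda>\<omega>. S n \<omega> - S m \<omega>) \<le> 2 * (1/2)^m" if "m \<le> n" for m n
  proof -
    have "nm (\<lambda>\<omega>. S n \<omega> - S m \<omega>) = nm (\<lambda>\<omega>. \<Sum>k\<in>{m..<n}. f k \<omega>)"
      using that by (simp add: S_def sum_diff_nat_ivl[of 0 m n, symmetric] lessThan_atLeast0 del: sum_diff_nat_ivl)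
    also have "\<dots> \<le> (\<Sum>k\<in>{m..<n}. (1/2)^k)"
      using nm_sum[of "{m..<n}" f] f le by (meson order_trans sum_mono)
    also have "\<dots> \<le> 2 * (1/2)^m"
    proof -
      have "(\<Sum>k\<in>{m..<n}. (1/2 :: real)^k) = 2 * (1/2)^m - 2 * (1/2)^n"
        using that by (induction n rule: dec_induct) simp_all
      then show ?thesis by simp
    qed
    finally show ?thesis .
  qed
  have small': "nm (\<lambda>\<omega>. S n \<omega> - S m \<omega>) \<le> 2 * (1/2)^k" if "k \<le> m" "k \<le> n" for k m n
  proof -
    have *: "(1/2::real)^m \<le> (1/2)^k" "(1/2::real)^n \<le> (1/2)^k"
      using that by (auto intro!: power_decreasing)
    have "nm (\<lambda>\<omega>. S n \<omega> - S m \<omega>) = nm (\<lambda>\<omega>. S m \<omega> - S n \<omega>)"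
      using nm_minus[OF Efun_diff[OF S[of n] S[of m]]] by simp
    then show ?thesis
      using small[of m n] small[of n m] * by (cases "m \<le> n") linarith+
  qed
  obtain g where g: "Efun g" "(\<lambda>n. nm (\<lambda>\<omega>. S n \<omega> - g \<omega>)) \<longlonglongrightarrow> 0"
  proof (rule E_complete[OF S])
    fix e :: real assume "e > 0"
    have "(\<lambda>n. 2 * (1/2::real)^n) \<longlonglongrightarrow> 2 * 0"
      by (intro tendsto_intros LIMSEQ_power_zero) auto
    then have "\<forall>\<^sub>F n in sequentially. 2 * (1/2::real)^n < e"
      by (rule order_tendstoD(2)) (use \<open>e > 0\<close> in simp)
    then obtain k where "2 * (1/2::real)^k < e" by (auto simp: eventually_sequentially)
    then show "\<exists>k. \<forall>m\<ge>k. \<forall>n\<ge>k. nm (\<lambda>\<omega>. S m \<omega> - S n \<omega>) < e"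
      using small' by (intro exI[of _ k]) (meson le_less_trans)
  qed blast
  have "AE \<omega> in M. S n \<omega> \<le> g \<omega>" for n
  proof -
    \<comment> \<open>\<open>h\<close> does not depend on m, while its bounds tend to 0 with
      m.\<close>
    define h where "h \<omega> = max 0 (S n \<omega> - g \<omega>)" for \<omega>
    have h: "strongly_measurable M h"
      unfolding h_def using Efun_borel[OF S[of n]] Efun_borel[OF g(1)] by (simp add: strongly_measurable_real_iff)
    have "Efun h \<and> nm h \<le> nm (\<lambda>\<omega>. S m \<omega> - g \<omega>)" if "m \<ge> n" for m
    proof -
      have "S n \<omega> \<le> S m \<omega>" for \<omega>
        unfolding S_def using that nonneg by (intro sum_mono2) auto
      from this have "\<bar>h \<omega>\<bar> \<le> \<bar>S m \<omega> - g \<omega>\<bar>" for \<omega>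
        unfolding h_def by (smt (verit))
      then show ?thesis
        using Efun_ideal[OF h Efun_diff[OF S[of m] g(1)]] by auto
    qed
    note le = this
    then have "Efun h" by blast
    have "nm h \<le> 0"
    proof (rule tendsto_lowerbound[OF g(2)])
      show "\<forall>\<^sub>F m in sequentially. nm h \<le> nm (\<lambda>\<omega>. S m \<omega> - g \<omega>)"
        using eventually_ge_at_top[of n] by eventually_elim (use le in blast)
    qed simp
    then have "nm h = 0"
      using nm_nonneg[OF \<open>Efun h\<close>] by simp
    then have "AE \<omega> in M. h \<omega> = 0"
      using nm_eq_zero_iff[OF \<open>Efun h\<close>] by simp
    then show ?thesis
      by eventually_elim (auto simp: h_def max_def split: if_splits)
  qed
  then have "AE \<omega> in M. \<forall>n. S n \<omega> \<le> g \<omega>"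
    by (simp add: AE_all_countable)
  with g show thesis
    unfolding S_def by (intro that)
qed

section \<open>The vector-valued space, its completeness and total boundedness\<close>

lemma bfs_ext_iff:
  "\<phi> \<in> bfs_ext M E \<longleftrightarrow> \<phi> \<in> L0 M \<and> Efun (\<lambda>\<omega>. norm (rep \<phi> \<omega>))"
  using rep_L0(1)[of \<phi> M] strongly_measurable_norm[of M "rep \<phi>"]
  by (auto simp: bfs_ext_def lift1_def Efun_def)

lemma bfs_ext_rep:
  assumes "\<phi> \<in> bfs_ext M E"
  shows "strongly_measurable M (rep \<phi>)" "Efun (\<lambda>\<omega>. norm (rep \<phi> \<omega>))"
  using assms rep_L0(1)[of \<phi> M] by (auto simp: bfs_ext_iff)

text \<open>The distance of \<open>bfs_ext M E\<close> without the default value outside the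
  carrier, written through representatives so that pointwise estimates apply.\<close>

definition distX :: "('w \<Rightarrow> 'x::real_normed_vector) set \<Rightarrow> ('w \<Rightarrow> 'x) set \<Rightarrow> real" where
  "distX \<phi> \<psi> = nm (\<lambda>\<omega>. norm (rep \<phi> \<omega> - rep \<psi> \<omega>))"

lemma Efun_norm_diff:
  assumes "\<phi> \<in> bfs_ext M E" "\<psi> \<in> bfs_ext M E"
  shows "Efun (\<lambda>\<omega>. norm (rep \<phi> \<omega> - rep \<psi> \<omega>))"
proof (rule Efun_ideal(1))
  show "strongly_measurable M (\<lambda>\<omega>. norm (rep \<phi> \<omega> - rep \<psi> \<omega>))"
    using assms by (intro strongly_measurable_norm strongly_measurable_diff bfs_ext_rep)
  show "Efun (\<lambda>\<omega>. norm (rep \<phi> \<omega>) + norm (rep \<psi> \<omega>))"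
    using assms by (intro Efun_add bfs_ext_rep)
qed (auto intro!: always_eventually order_trans[OF norm_triangle_ineq4])

lemma norm_dist_ext:
  assumes "\<phi> \<in> bfs_ext M E" "\<psi> \<in> bfs_ext M E"
  shows "norm_dist M (bfs_ext M E) (bfs_ext_norm M N) \<phi> \<psi> = distX \<phi> \<psi>"
proof -
  have "strongly_measurable M (\<lambda>\<omega>. rep \<phi> \<omega> - rep \<psi> \<omega>)"
    using assms by (intro strongly_measurable_diff bfs_ext_rep)
  then show ?thesis
    using assms by (simp add: norm_dist_def bfs_ext_norm_def lift2_def lift1_ae_class distX_def nm_def)
qed

lemma distX_commute: "distX \<phi> \<psi> = distX \<psi> \<phi>"
  by (simp add: distX_def norm_minus_commute)

lemma distX_nonneg:
  "\<phi> \<in> bfs_ext M E \<Longrightarrow> \<psi> \<in> bfs_ext M E \<Longrightarrow> 0 \<le> distX \<phi> \<psi>"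
  unfolding distX_def by (intro nm_nonneg Efun_norm_diff)

lemma distX_triangle:
  assumes *: "\<phi> \<in> bfs_ext M E" "\<psi> \<in> bfs_ext M E" "\<theta> \<in> bfs_ext M E"
  shows "distX \<phi> \<theta> \<le> distX \<phi> \<psi> + distX \<psi> \<theta>"
proof -
  have sm: "strongly_measurable M (\<lambda>\<omega>. norm (rep \<phi> \<omega> - rep \<theta> \<omega>))"
    using * by (intro strongly_measurable_norm strongly_measurable_diff bfs_ext_rep)
  have "distX \<phi> \<theta> \<le> nm (\<lambda>\<omega>. norm (rep \<phi> \<omega> - rep \<psi> \<omega>) + norm (rep \<psi> \<omega> - rep \<theta> \<omega>))"
    unfolding distX_def using *
  proof (intro Efun_ideal(2) sm Efun_add Efun_norm_diff always_eventually allI)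
    show "\<bar>norm (rep \<phi> \<omega> - rep \<theta> \<omega>)\<bar> \<le> \<bar>norm (rep \<phi> \<omega> - rep \<psi> \<omega>) + norm (rep \<psi> \<omega> - rep \<theta> \<omega>)\<bar>" for \<omega>
      using norm_triangle_ineq[of "rep \<phi> \<omega> - rep \<psi> \<omega>" "rep \<psi> \<omega> - rep \<theta> \<omega>"] by simp
  qed
  also have "\<dots> \<le> distX \<phi> \<psi> + distX \<psi> \<theta>"
    unfolding distX_def using * by (intro nm_add Efun_norm_diff)
  finally show ?thesis .
qed

lemma Metric_space_ext:
  "Metric_space (bfs_ext M E) (norm_dist M (bfs_ext M E) (bfs_ext_norm M N))"
proof
  fix \<phi> \<psi> :: "('w \<Rightarrow> 'x::real_normed_vector) set"
  show "0 \<le> norm_dist M (bfs_ext M E) (bfs_ext_norm M N) \<phi> \<psi>"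
    using norm_dist_ext[of \<phi> \<psi>] distX_nonneg[of \<phi> \<psi>] by (auto simp: norm_dist_def)
  show "norm_dist M (bfs_ext M E) (bfs_ext_norm M N) \<phi> \<psi> = norm_dist M (bfs_ext M E) (bfs_ext_norm M N) \<psi> \<phi>"
    using norm_dist_ext[of \<phi> \<psi>] norm_dist_ext[of \<psi> \<phi>] distX_commute[of \<phi> \<psi>] by (auto simp: norm_dist_def)
next
  fix \<phi> \<psi> :: "('w \<Rightarrow> 'x::real_normed_vector) set"
  assume *: "\<phi> \<in> bfs_ext M E" "\<psi> \<in> bfs_ext M E"
  have "\<phi> = \<psi> \<longleftrightarrow> (AE \<omega> in M. rep \<phi> \<omega> = rep \<psi> \<omega>)"
    using rep_L0[of \<phi> M] rep_L0[of \<psi> M] * ae_class_cong[of "rep \<phi>" "rep \<psi>" M]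
    by (auto simp: bfs_ext_iff)
  then show "norm_dist M (bfs_ext M E) (bfs_ext_norm M N) \<phi> \<psi> = 0 \<longleftrightarrow> \<phi> = \<psi>"
    using nm_eq_zero_iff[OF Efun_norm_diff[OF *]] by (simp add: norm_dist_ext[OF *] distX_def)
next
  fix \<phi> \<psi> \<theta> :: "('w \<Rightarrow> 'x::real_normed_vector) set"
  assume "\<phi> \<in> bfs_ext M E" "\<psi> \<in> bfs_ext M E" "\<theta> \<in> bfs_ext M E"
  then show "norm_dist M (bfs_ext M E) (bfs_ext_norm M N) \<phi> \<theta> \<le>
      norm_dist M (bfs_ext M E) (bfs_ext_norm M N) \<phi> \<psi> + norm_dist M (bfs_ext M E) (bfs_ext_norm M N) \<psi> \<theta>"
    by (simp add: norm_dist_ext distX_triangle)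
qed

text \<open>Along a subsequence the increments have norms at most 2^-k, so \<open>E_summable\<close>
  majorises the sum of their pointwise norms by some \<open>g\<close> in \<open>E\<close>. As
  \<open>'x\<close> is complete, the subsequence converges almost everywhere, and \<open>g\<close>
  minus the k-th partial sum dominates the k-th error. These differences tend to 0 in norm, and a
  Cauchy sequence with a convergent subsequence converges.\<close>

lemma ext_complete:
  "Metric_space.mcomplete (bfs_ext M E :: ('w \<Rightarrow> 'x::banach) set set)
     (norm_dist M (bfs_ext M E) (bfs_ext_norm M N))"
proof -
  let ?d = "norm_dist M (bfs_ext M E) (bfs_ext_norm M N) :: ('w \<Rightarrow> 'x) set \<Rightarrow> _"
  interpret X: Metric_space "bfs_ext M E :: ('w \<Rightarrow> 'x) set set" ?d
    by (rule Metric_space_ext)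
  show ?thesis
    unfolding X.mcomplete_def
  proof (intro allI impI)
    fix \<sigma> assume \<sigma>: "X.MCauchy \<sigma>"
    then have mem: "\<sigma> n \<in> bfs_ext M E" for n by (auto simp: X.MCauchy_def)
    have "\<exists>K. \<forall>m\<ge>K. \<forall>n\<ge>K. distX (\<sigma> m) (\<sigma> n) < (1/2)^k" for k :: nat
    proof -
      have "(1/2::real)^k > 0" by simp
      with \<sigma> obtain K where "\<forall>m n. K \<le> m \<longrightarrow> K \<le> n \<longrightarrow> ?d (\<sigma> m) (\<sigma> n) < (1/2)^k"
        unfolding X.MCauchy_def by blast
      then show ?thesis using norm_dist_ext[OF mem mem] by auto
    qed
    then have "\<forall>k. \<exists>K. \<forall>m\<ge>K. \<forall>n\<ge>K. distX (\<sigma> m) (\<sigma> n) < (1/2)^k" by blast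
    from choice[OF this] obtain K where K: "\<forall>k. \<forall>m\<ge>K k. \<forall>n\<ge>K k. distX (\<sigma> m) (\<sigma> n) < (1/2)^k" ..
    \<comment> \<open>Summing all earlier thresholds ensures \<open>r k \<ge> K k\<close>; the
      summand k makes \<open>r\<close> strictly increasing.\<close>
    define r where "r k = (\<Sum>j\<le>k. K j) + k" for k
    have r_mono: "strict_mono r"
      by (auto simp: strict_mono_Suc_iff r_def)
    have r_ge: "r k \<ge> K k" for k
      using member_le_sum[of k "{..k}" K] by (simp add: r_def)
    define \<psi> where "\<psi> k = rep (\<sigma> (r k))" for k
    define f where "f k \<omega> = norm (\<psi> (Suc k) \<omega> - \<psi> k \<omega>)" for k \<omega>
    have f: "Efun (f k)" for k
      unfolding f_def \<psi>_def by (intro Efun_norm_diff mem)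
    have "nm (f k) \<le> (1/2)^k" for k
    proof -
      have "r (Suc k) \<ge> K k"
        using r_ge[of k] strict_monoD[OF r_mono, of k "Suc k"] by simp
      then show ?thesis
        using K[rule_format, of k "r (Suc k)" "r k"] r_ge[of k] by (simp add: f_def[abs_def] \<psi>_def distX_def)
    qed
    then obtain g where g: "Efun g" "AE \<omega> in M. \<forall>n. (\<Sum>k<n. f k \<omega>) \<le> g \<omega>"
        "(\<lambda>n. nm (\<lambda>\<omega>. (\<Sum>k<n. f k \<omega>) - g \<omega>)) \<longlonglongrightarrow> 0"
      using E_summable[of f] f by (auto simp: f_def)
    \<comment> \<open>Where the sequence diverges, \<open>lim\<close> is an unspecified value; this
      concerns a null set only.\<close>
    define h where "h \<omega> = lim (\<lambda>k. \<psi> k \<omega>)" for \<omega>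
    have "AE \<omega> in M. (\<lambda>k. \<psi> k \<omega>) \<longlonglongrightarrow> h \<omega> \<and> (\<forall>k. norm (h \<omega> - \<psi> k \<omega>) \<le> g \<omega> - (\<Sum>j<k. f j \<omega>))"
      using g(2)
    proof eventually_elim
      case (elim \<omega>)
      have "summable (\<lambda>k. f k \<omega>)"
        using elim by (intro summableI_nonneg_bounded[where x = "g \<omega>"]) (auto simp: f_def)
      then have "summable (\<lambda>k. \<psi> (Suc k) \<omega> - \<psi> k \<omega>)"
        unfolding f_def by (rule summable_norm_cancel)
      then have "convergent (\<lambda>n. \<Sum>k<n. \<psi> (Suc k) \<omega> - \<psi> k \<omega>)"
        by (simp add: summable_iff_convergent)
      then have "convergent (\<lambda>n. \<psi> n \<omega> - \<psi> 0 \<omega>)"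
        by (simp only: sum_lessThan_telescope[of "\<lambda>k. \<psi> k \<omega>"])
      then have "convergent (\<lambda>n. \<psi> n \<omega>)"
        by (simp add: convergent_diff_const_right_iff)
      then have lim: "(\<lambda>k. \<psi> k \<omega>) \<longlonglongrightarrow> h \<omega>"
        unfolding h_def by (simp add: convergent_LIMSEQ_iff)
      have "norm (h \<omega> - \<psi> k \<omega>) \<le> g \<omega> - (\<Sum>j<k. f j \<omega>)" for k
      proof (rule tendsto_upperbound)
        show "(\<lambda>n. norm (\<psi> n \<omega> - \<psi> k \<omega>)) \<longlonglongrightarrow> norm (h \<omega> - \<psi> k \<omega>)"
          by (intro tendsto_intros lim)
        show "\<forall>\<^sub>F n in sequentially. norm (\<psi> n \<omega> - \<psi> k \<omega>) \<le> g \<omega> - (\<Sum>j<k. f j \<omega>)"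
          using eventually_ge_at_top[of k]
        proof eventually_elim
          case n: (elim n)
          have "norm (\<psi> n \<omega> - \<psi> k \<omega>) \<le> (\<Sum>j=k..<n. f j \<omega>)"
            using n
          proof (induction n rule: dec_induct)
            case (step m)
            then show ?case
              using norm_triangle_ineq[of "\<psi> m \<omega> - \<psi> k \<omega>" "\<psi> (Suc m) \<omega> - \<psi> m \<omega>"] by (simp add: f_def)
          qed auto
          also have "\<dots> = (\<Sum>j<n. f j \<omega>) - (\<Sum>j<k. f j \<omega>)"
            using n by (simp add: sum_diff_nat_ivl[of 0 k n, symmetric] lessThan_atLeast0 del: sum_diff_nat_ivl)
          also have "\<dots> \<le> g \<omega> - (\<Sum>j<k. f j \<omega>)" using elim by simp
          finally show ?case .
        qed
      qed auto
      with lim show ?case by blast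
    qed
    then have lim: "AE \<omega> in M. (\<lambda>k. \<psi> k \<omega>) \<longlonglongrightarrow> h \<omega>"
      and bound: "AE \<omega> in M. norm (h \<omega> - \<psi> k \<omega>) \<le> g \<omega> - (\<Sum>j<k. f j \<omega>)" for k
      by (auto elim: eventually_mono)
    have h: "strongly_measurable M h"
      by (rule strongly_measurable_LIMSEQ[OF _ lim]) (auto simp: \<psi>_def intro: bfs_ext_rep mem)
    define x where "x = ae_class M h"
    have rx: "AE \<omega> in M. rep x \<omega> = h \<omega>" "strongly_measurable M (rep x)"
      unfolding x_def using rep_ae_class[OF h] by auto
    have x: "x \<in> bfs_ext M E"
      unfolding bfs_ext_iff
    proof
      show "x \<in> L0 M" unfolding x_def by (rule ae_class_in_L0[OF h])
      show "Efun (\<lambda>\<omega>. norm (rep x \<omega>))"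
      proof (rule Efun_ideal(1))
        \<comment> \<open>For k = 0 the partial sum is empty, so the distance of \<open>h\<close>
          from \<open>\<psi> 0\<close> is at most \<open>g\<close>.\<close>
        show "Efun (\<lambda>\<omega>. g \<omega> + norm (\<psi> 0 \<omega>))"
          unfolding \<psi>_def by (intro Efun_add g bfs_ext_rep mem)
        show "AE \<omega> in M. \<bar>norm (rep x \<omega>)\<bar> \<le> \<bar>g \<omega> + norm (\<psi> 0 \<omega>)\<bar>"
          using rx(1) bound[of 0]
        proof eventually_elim
          case (elim \<omega>)
          then show ?case
            using norm_triangle_ineq[of "h \<omega> - \<psi> 0 \<omega>" "\<psi> 0 \<omega>"] by simp
        qed
      qed (intro strongly_measurable_norm rx)
    qed
    have "limitin X.mtopology (\<sigma> \<circ> r) x sequentially"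
      unfolding X.limitin_metric_dist_null
    proof (intro conjI)
      show "((\<lambda>k. ?d ((\<sigma> \<circ> r) k) x) \<longlongrightarrow> 0) sequentially"
      proof (rule tendsto_sandwich[OF _ _ tendsto_const g(3)])
        show "\<forall>\<^sub>F k in sequentially. ?d ((\<sigma> \<circ> r) k) x \<le> nm (\<lambda>\<omega>. (\<Sum>j<k. f j \<omega>) - g \<omega>)"
        proof (intro always_eventually allI)
          fix k
          have "AE \<omega> in M. \<bar>norm (rep (\<sigma> (r k)) \<omega> - rep x \<omega>)\<bar> \<le> \<bar>(\<Sum>j<k. f j \<omega>) - g \<omega>\<bar>"
            using rx(1) bound[of k] by eventually_elim (auto simp: \<psi>_def norm_minus_commute)
          then have "distX (\<sigma> (r k)) x \<le> nm (\<lambda>\<omega>. (\<Sum>j<k. f j \<omega>) - g \<omega>)"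
            unfolding distX_def using Efun_norm_diff[OF mem[of "r k"] x]
            by (intro Efun_ideal(2) Efun_diff Efun_sum f g) (auto intro: EfunD)
          then show "?d ((\<sigma> \<circ> r) k) x \<le> nm (\<lambda>\<omega>. (\<Sum>j<k. f j \<omega>) - g \<omega>)"
            by (simp add: norm_dist_ext[OF mem x])
        qed
      qed auto
    qed (use x mem in auto)
    then show "\<exists>x. limitin X.mtopology \<sigma> x sequentially"
      using X.MCauchy_convergent_subsequence[OF \<sigma> r_mono] by blast
  qed
qed

text \<open>By completeness, compact closure is total boundedness. The net has its centres in
  \<open>F\<close>, which matches the later estimates, valid only for pairs of elements of
  \<open>F\<close>.\<close>

lemma relatively_compact_iff:
  fixes F :: "('w \<Rightarrow> 'x::banach) set set"
  shows "relatively_compact_in (bfs_ext_topology M E N) F \<longleftrightarrow>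
    F \<subseteq> bfs_ext M E \<and> (\<forall>e>0. \<exists>K. finite K \<and> K \<subseteq> F \<and> (\<forall>\<phi>\<in>F. \<exists>\<psi>\<in>K. distX \<psi> \<phi> < e))"
proof -
  let ?d = "norm_dist M (bfs_ext M E) (bfs_ext_norm M N) :: ('w \<Rightarrow> 'x) set \<Rightarrow> _"
  interpret X: Metric_space "bfs_ext M E :: ('w \<Rightarrow> 'x) set set" ?d
    by (rule Metric_space_ext)
  have "F \<subseteq> (\<Union>\<psi>\<in>K. X.mball \<psi> e) \<longleftrightarrow> (\<forall>\<phi>\<in>F. \<exists>\<psi>\<in>K. distX \<psi> \<phi> < e)"
    if "F \<subseteq> bfs_ext M E" "K \<subseteq> F" for K e
  proof -
    have "\<phi> \<in> X.mball \<psi> e \<longleftrightarrow> distX \<psi> \<phi> < e" if "\<phi> \<in> F" "\<psi> \<in> K" for \<phi> \<psi>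
    proof -
      have "\<phi> \<in> bfs_ext M E" "\<psi> \<in> bfs_ext M E" using that \<open>F \<subseteq> bfs_ext M E\<close> \<open>K \<subseteq> F\<close> by auto
      then show ?thesis by (simp add: X.in_mball norm_dist_ext)
    qed
    then show ?thesis by blast
  qed
  then have "F \<subseteq> bfs_ext M E \<Longrightarrow> X.mtotally_bounded F \<longleftrightarrow>
      (\<forall>e>0. \<exists>K. finite K \<and> K \<subseteq> F \<and> (\<forall>\<phi>\<in>F. \<exists>\<psi>\<in>K. distX \<psi> \<phi> < e))"
    unfolding X.mtotally_bounded_def by (metis (no_types, lifting))
  moreover have "relatively_compact_in (bfs_ext_topology M E N) F \<longleftrightarrow> X.mtotally_bounded F"
    unfolding relatively_compact_in_def bfs_ext_topology_def X.mtotally_bounded_eq_compact_closure_of[OF ext_complete]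
    by simp
  ultimately show ?thesis
    using X.mtotally_bounded_imp_subset[of F] by (cases "F \<subseteq> bfs_ext M E") auto
qed

end

section \<open>Consequences of relative compactness\<close>

text \<open>Representatives are Borel for the completion, so events described by them are measured
  in \<open>C\<close>.\<close>

sublocale prob_bfs \<subseteq> C: prob_space "completion M"
  by (rule prob_space_completion)

context prob_bfs
begin

section \<open>Distributions, and images under bounded linear maps\<close>

lemma borel_rep: "\<phi> \<in> bfs_ext M E \<Longrightarrow> rep \<phi> \<in> borel_measurable (completion M)"
  by (intro strongly_measurable_imp_borel bfs_ext_rep)

lemma measure_distribution:
  assumes "\<phi> \<in> bfs_ext M E" "B \<in> sets borel"
  shows "measure (distribution M \<phi>) B = C.prob {\<omega>\<in>space M. rep \<phi> \<omega> \<in> B}"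
  unfolding distribution_def measure_distr[OF borel_rep[OF assms(1)] assms(2)]
  by (intro arg_cong[where f = C.prob]) auto

lemma measure_distribution_compl:
  assumes "\<phi> \<in> bfs_ext M E" "B \<in> sets borel"
  shows "measure (distribution M \<phi>) B = 1 - C.prob {\<omega>\<in>space M. rep \<phi> \<omega> \<notin> B}"
proof -
  have "{\<omega>\<in>space M. rep \<phi> \<omega> \<in> B} \<in> C.events"
    using measurable_sets[OF borel_rep[OF assms(1)] assms(2)] by (simp add: vimage_def Int_def conj_commute)
  from C.prob_compl[OF this] show ?thesis
    unfolding measure_distribution[OF assms] by (simp add: set_diff_eq conj_disj_distribL cong: conj_cong)
qed

lemma lift1_ext:
  fixes h :: "'x::real_normed_vector \<Rightarrow> 'y::real_normed_vector"
  assumes h: "bounded_linear h" and \<phi>: "\<phi> \<in> bfs_ext M E"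
  shows "lift1 M h \<phi> \<in> bfs_ext M E" "AE \<omega> in M. rep (lift1 M h \<phi>) \<omega> = h (rep \<phi> \<omega>)"
proof -
  have sm: "strongly_measurable M (\<lambda>\<omega>. h (rep \<phi> \<omega>))"
    using h \<phi> by (intro strongly_measurable_compose[of M "rep \<phi>" h] bfs_ext_rep linear_continuous_on)
  show r: "AE \<omega> in M. rep (lift1 M h \<phi>) \<omega> = h (rep \<phi> \<omega>)"
    unfolding lift1_def by (rule rep_ae_class(1)[OF sm])
  obtain B where B: "\<And>x. norm (h x) \<le> norm x * B"
    using bounded_linear.bounded[OF h] by blast
  have "Efun (\<lambda>\<omega>. norm (rep (lift1 M h \<phi>) \<omega>))"
  proof (rule Efun_ideal(1))
    show "strongly_measurable M (\<lambda>\<omega>. norm (rep (lift1 M h \<phi>) \<omega>))"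
      unfolding lift1_def by (intro strongly_measurable_norm rep_ae_class sm)
    show "Efun (\<lambda>\<omega>. B * norm (rep \<phi> \<omega>))"
      by (intro Efun_scale bfs_ext_rep \<phi>)
    show "AE \<omega> in M. \<bar>norm (rep (lift1 M h \<phi>) \<omega>)\<bar> \<le> \<bar>B * norm (rep \<phi> \<omega>)\<bar>"
      using r
    proof eventually_elim
      case (elim \<omega>)
      then show ?case using B[of "rep \<phi> \<omega>"] by (simp add: mult.commute)
    qed
  qed
  then show "lift1 M h \<phi> \<in> bfs_ext M E"
    using ae_class_in_L0[OF sm] by (simp add: bfs_ext_iff lift1_def)
qed

lemma distX_lift1:
  fixes h :: "'x::real_normed_vector \<Rightarrow> 'y::real_normed_vector"
  assumes h: "bounded_linear h" and "\<phi> \<in> bfs_ext M E" "\<psi> \<in> bfs_ext M E"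
  shows "distX (lift1 M h \<phi>) (lift1 M h \<psi>) = nm (\<lambda>\<omega>. norm (h (rep \<phi> \<omega> - rep \<psi> \<omega>)))"
  unfolding distX_def
proof (rule Efun_cong(1))
  show "AE \<omega> in M. norm (rep (lift1 M h \<phi>) \<omega> - rep (lift1 M h \<psi>) \<omega>) = norm (h (rep \<phi> \<omega> - rep \<psi> \<omega>))"
    using lift1_ext(2)[OF h assms(2)] lift1_ext(2)[OF h assms(3)]
    by eventually_elim (simp add: linear_diff[OF bounded_linear.linear[OF h]])
qed

lemma Efun_norm_diff_image:
  fixes h :: "'x::real_normed_vector \<Rightarrow> 'y::real_normed_vector"
  assumes h: "bounded_linear h" and "\<phi> \<in> bfs_ext M E" "\<psi> \<in> bfs_ext M E"
  shows "Efun (\<lambda>\<omega>. norm (h (rep \<phi> \<omega> - rep \<psi> \<omega>)))"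
proof (rule Efun_cong(2))
  show "AE \<omega> in M. norm (rep (lift1 M h \<phi>) \<omega> - rep (lift1 M h \<psi>) \<omega>) = norm (h (rep \<phi> \<omega> - rep \<psi> \<omega>))"
    using lift1_ext(2)[OF h assms(2)] lift1_ext(2)[OF h assms(3)]
    by eventually_elim (simp add: linear_diff[OF bounded_linear.linear[OF h]])
  show "Efun (\<lambda>\<omega>. norm (rep (lift1 M h \<phi>) \<omega> - rep (lift1 M h \<psi>) \<omega>))"
    using assms by (intro Efun_norm_diff lift1_ext)
qed

text \<open>A bounded linear map is Lipschitz from one function space to the other, so it carries
  finite nets to finite nets. It is applied to functionals over either field and to the real
  part.\<close>

lemma relatively_compact_lift1:
  fixes h :: "'x::banach \<Rightarrow> 'y::banach"
  assumes h: "bounded_linear h" and F: "relatively_compact_in (bfs_ext_topology M E N) F"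
  shows "relatively_compact_in (bfs_ext_topology M E N) (lift1 M h ` F)"
proof -
  have sub: "F \<subseteq> bfs_ext M E"
    and net: "\<And>e. e > 0 \<Longrightarrow> \<exists>K. finite K \<and> K \<subseteq> F \<and> (\<forall>\<phi>\<in>F. \<exists>\<psi>\<in>K. distX \<psi> \<phi> < e)"
    using F unfolding relatively_compact_iff by auto
  obtain B where B: "B > 0" "\<And>x. norm (h x) \<le> norm x * B"
    using bounded_linear.pos_bounded[OF h] by blast
  have lip: "distX (lift1 M h \<psi>) (lift1 M h \<phi>) \<le> B * distX \<psi> \<phi>" if "\<phi> \<in> F" "\<psi> \<in> F" for \<phi> \<psi>
  proof -
    have *: "\<phi> \<in> bfs_ext M E" "\<psi> \<in> bfs_ext M E" using that sub by auto
    have "distX (lift1 M h \<psi>) (lift1 M h \<phi>) \<le> nm (\<lambda>\<omega>. B * norm (rep \<psi> \<omega> - rep \<phi> \<omega>))"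
      unfolding distX_lift1[OF h *(2,1)]
      using * B by (intro Efun_ideal(2) EfunD[OF Efun_norm_diff_image[OF h]] Efun_scale Efun_norm_diff)
        (auto simp: mult.commute intro!: always_eventually)
    then show ?thesis
      using nm_scale[OF Efun_norm_diff[OF *(2,1)], of B] B(1) by (simp add: distX_def)
  qed
  show ?thesis
    unfolding relatively_compact_iff
  proof (intro conjI allI impI)
    show "lift1 M h ` F \<subseteq> bfs_ext M E"
      using sub lift1_ext(1)[OF h] by auto
    fix e :: real assume "e > 0"
    then obtain K where K: "finite K" "K \<subseteq> F" "\<And>\<phi>. \<phi> \<in> F \<Longrightarrow> \<exists>\<psi>\<in>K. distX \<psi> \<phi> < e / B"
      using net[of "e / B"] B(1) by auto
    have "\<exists>\<psi>\<in>K. distX (lift1 M h \<psi>) (lift1 M h \<phi>) < e" if "\<phi> \<in> F" for \<phi>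
    proof -
      obtain \<psi> where "\<psi> \<in> K" "distX \<psi> \<phi> < e / B" using K(3)[OF \<open>\<phi> \<in> F\<close>] by blast
      moreover have "B * distX \<psi> \<phi> < e"
        using \<open>distX \<psi> \<phi> < e / B\<close> B(1) by (simp add: field_simps)
      ultimately show ?thesis
        using lip[OF that, of \<psi>] K(2) by (meson le_less_trans subsetD)
    qed
    then show "\<exists>K. finite K \<and> K \<subseteq> lift1 M h ` F \<and> (\<forall>\<phi>\<in>lift1 M h ` F. \<exists>\<psi>\<in>K. distX \<psi> \<phi> < e)"
      using K(1,2) by (intro exI[of _ "lift1 M h ` K"]) auto
  qed
qed

lemma lift1_lift1:
  fixes h :: "'x::real_normed_vector \<Rightarrow> 'y::real_normed_vector"
  assumes "bounded_linear h" "\<phi> \<in> bfs_ext M E"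
  shows "lift1 M k (lift1 M h \<phi>) = lift1 M (\<lambda>x. k (h x)) \<phi>"
  unfolding lift1_def[of M h]
  using assms by (subst lift1_ae_class)
    (auto simp: lift1_def intro!: strongly_measurable_compose[of M "rep \<phi>" h] bfs_ext_rep linear_continuous_on)

section \<open>Tightness and almost order boundedness\<close>

text \<open>Counterexamples with norms below 2^-n would form a series bounded almost everywhere by a
  finite function. Their values then tend to 0 almost everywhere, so the unions of the tails of the
  events decrease to a null set, although each event has probability at least e.\<close>

lemma small_norm_imp_small_in_measure:
  assumes "e > 0"
  shows "\<exists>\<delta>>0. \<forall>f. Efun f \<longrightarrow> nm f < \<delta> \<longrightarrow> C.prob {\<omega>\<in>space M. e < \<bar>f \<omega>\<bar>} < e"
proof (rule ccontr)
  assume "\<not> ?thesis"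
  then have neg: "\<exists>f. Efun f \<and> nm f < \<delta> \<and> \<not> C.prob {\<omega>\<in>space M. e < \<bar>f \<omega>\<bar>} < e" if "\<delta> > 0" for \<delta>
    using that by blast
  have "\<forall>n. \<exists>f. Efun f \<and> nm f < (1/2)^n \<and> \<not> C.prob {\<omega>\<in>space M. e < \<bar>f \<omega>\<bar>} < e"
    by (intro allI neg) simp
  from choice[OF this] obtain f where f: "\<And>n. Efun (f n)" "\<And>n. nm (f n) < (1/2)^n"
    "\<And>n. \<not> C.prob {\<omega>\<in>space M. e < \<bar>f n \<omega>\<bar>} < e" by blast
  have fa: "Efun (\<lambda>\<omega>. \<bar>f n \<omega>\<bar>)" "nm (\<lambda>\<omega>. \<bar>f n \<omega>\<bar>) \<le> (1/2)^n" for n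
    using Efun_abs[OF f(1)[of n]] f(2)[of n] by auto
  obtain g where g: "AE \<omega> in M. \<forall>n. (\<Sum>k<n. \<bar>f k \<omega>\<bar>) \<le> g \<omega>"
    by (rule E_summable[of "\<lambda>n \<omega>. \<bar>f n \<omega>\<bar>", OF fa(1) _ fa(2)]) auto
  define A where "A n = {\<omega>\<in>space M. e < \<bar>f n \<omega>\<bar>}" for n
  have A: "A n \<in> C.events" for n
    unfolding A_def using Efun_borel[OF f(1)[of n]]
    using borel_measurable_less[of "\<lambda>_. e" "completion M" "\<lambda>\<omega>. \<bar>f n \<omega>\<bar>"] by simp
  define B where "B n = (\<Union>m\<in>{n..}. A m)" for n
  have B: "B n \<in> C.events" for n
    unfolding B_def using A by auto
  have "decseq B" unfolding B_def decseq_def by fastforce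
  have "C.prob (\<Inter>n. B n) = 0"
  proof (rule C.prob_eq_0[THEN iffD2])
    show "(\<Inter>n. B n) \<in> C.events" using B by auto
    have "AE \<omega> in M. \<omega> \<notin> (\<Inter>n. B n)"
      using g
    proof eventually_elim
      case (elim \<omega>)
      then have "summable (\<lambda>k. \<bar>f k \<omega>\<bar>)"
        by (intro summableI_nonneg_bounded[where x = "g \<omega>"]) auto
      then have "(\<lambda>k. \<bar>f k \<omega>\<bar>) \<longlonglongrightarrow> 0" by (rule summable_LIMSEQ_zero)
      then have "\<forall>\<^sub>F k in sequentially. \<bar>f k \<omega>\<bar> < e"
        using \<open>e > 0\<close> by (rule order_tendstoD)
      then obtain n where "\<And>k. k \<ge> n \<Longrightarrow> \<bar>f k \<omega>\<bar> < e" by (auto simp: eventually_sequentially)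
      then have "\<omega> \<notin> B n" by (force simp: B_def A_def)
      then show ?case by blast
    qed
    then show "AE \<omega> in completion M. \<omega> \<notin> (\<Inter>n. B n)" by (rule AE_completion)
  qed
  moreover have "(\<lambda>n. C.prob (B n)) \<longlonglongrightarrow> C.prob (\<Inter>n. B n)"
    using B \<open>decseq B\<close> by (intro C.finite_Lim_measure_decseq) auto
  ultimately have "(\<lambda>n. C.prob (B n)) \<longlonglongrightarrow> 0" by simp
  then have "\<forall>\<^sub>F n in sequentially. C.prob (B n) < e"
    using \<open>e > 0\<close> by (rule order_tendstoD)
  then obtain n where "C.prob (B n) < e" by (auto simp: eventually_sequentially)
  moreover have "C.prob (A n) \<le> C.prob (B n)"
    using B by (intro C.finite_measure_mono) (auto simp: B_def)
  ultimately show False using f(3)[of n] by (simp add: A_def)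
qed

lemma far_from_finite_event:
  fixes f :: "'w \<Rightarrow> 'x::metric_space"
  assumes "f \<in> borel_measurable (completion M)" "finite S"
  shows "{\<omega>\<in>space M. \<forall>s\<in>S. a < dist (f \<omega>) s} \<in> C.events"
proof -
  have "{\<omega>\<in>space M. \<forall>s\<in>S. a < dist (f \<omega>) s} =
      space (completion M) - f -` (\<Union>s\<in>S. cball s a) \<inter> space (completion M)"
    by (auto simp: dist_commute not_le)
  also have "\<dots> \<in> C.events"
    using assms by (intro sets.Diff measurable_sets[OF assms(1)] borel_closed closed_UN) auto
  finally show ?thesis .
qed

text \<open>\<open>S\<close> is the finite range of a simple function close to \<open>f\<close> in
  probability; this is how a single function is almost carried by finitely many balls in a possibly
  nonseparable space.\<close>

lemma strongly_measurable_finite_approx: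
  fixes f :: "'w \<Rightarrow> 'x::metric_space"
  assumes f: "strongly_measurable M f" and a: "a > 0"
  obtains S where "finite S" "C.prob {\<omega>\<in>space M. \<forall>s\<in>S. a < dist (f \<omega>) s} < a"
proof -
  obtain s A where s: "simple_function M s" and A: "A \<in> sets M" "prob A < a"
    and d: "AE \<omega> in M. \<omega> \<notin> A \<longrightarrow> dist (f \<omega>) (s \<omega>) \<le> a"
    by (rule strongly_measurable_approx[OF f a])
  have "AE \<omega> in M. \<omega> \<in> {\<omega>\<in>space M. \<forall>x\<in>s ` space M. a < dist (f \<omega>) x} \<longrightarrow> \<omega> \<in> A"
    using d by eventually_elim (auto simp: not_le[symmetric])
  then have "C.prob {\<omega>\<in>space M. \<forall>x\<in>s ` space M. a < dist (f \<omega>) x} \<le> C.prob A"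
    using A(1) by (intro C.finite_measure_mono_AE AE_completion) auto
  with A have "C.prob {\<omega>\<in>space M. \<forall>x\<in>s ` space M. a < dist (f \<omega>) x} < a" by simp
  then show thesis
    using simple_functionD(1)[OF s] by (intro that[of "s ` space M"]) auto
qed

text \<open>Radius and probability are each split in halves: one half for the distance of a net
  element \<psi> from its finite set, one for the distance of \<phi> from \<psi>. The union over the
  finite net serves all of \<open>F\<close>.\<close>

lemma relatively_compact_imp_finite_approx:
  fixes F :: "('w \<Rightarrow> 'x::banach) set set"
  assumes F: "relatively_compact_in (bfs_ext_topology M E N) F" and a: "a > 0"
  shows "\<exists>S. finite S \<and> (\<forall>\<phi>\<in>F. C.prob {\<omega>\<in>space M. \<forall>s\<in>S. a < dist (rep \<phi> \<omega>) s} \<le> a)"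
proof -
  have sub: "F \<subseteq> bfs_ext M E"
    and net: "\<And>e. e > 0 \<Longrightarrow> \<exists>K. finite K \<and> K \<subseteq> F \<and> (\<forall>\<phi>\<in>F. \<exists>\<psi>\<in>K. distX \<psi> \<phi> < e)"
    using F unfolding relatively_compact_iff by auto
  have a2: "a / 2 > 0" using a by simp
  obtain \<delta> where \<delta>: "\<delta> > 0"
    "\<And>f. Efun f \<Longrightarrow> nm f < \<delta> \<Longrightarrow> C.prob {\<omega>\<in>space M. a / 2 < \<bar>f \<omega>\<bar>} < a / 2"
    using small_norm_imp_small_in_measure[OF a2] by blast
  obtain K where K: "finite K" "K \<subseteq> F" "\<And>\<phi>. \<phi> \<in> F \<Longrightarrow> \<exists>\<psi>\<in>K. distX \<psi> \<phi> < \<delta>"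
    using net[OF \<delta>(1)] by blast
  have Ksm: "strongly_measurable M (rep \<psi>)" if "\<psi> \<in> K" for \<psi>
    using that K(2) sub by (intro bfs_ext_rep) auto
  have "\<forall>\<psi>\<in>K. \<exists>S. finite S \<and> C.prob {\<omega>\<in>space M. \<forall>s\<in>S. a / 2 < dist (rep \<psi> \<omega>) s} < a / 2"
    using strongly_measurable_finite_approx[OF Ksm a2] by blast
  from bchoice[OF this] obtain S where S: "\<And>\<psi>. \<psi> \<in> K \<Longrightarrow> finite (S \<psi>)"
    "\<And>\<psi>. \<psi> \<in> K \<Longrightarrow> C.prob {\<omega>\<in>space M. \<forall>s\<in>S \<psi>. a / 2 < dist (rep \<psi> \<omega>) s} < a / 2" by blast
  define T where "T = (\<Union>\<psi>\<in>K. S \<psi>)"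
  have "finite T" using K(1) S(1) by (auto simp: T_def)
  moreover have "C.prob {\<omega>\<in>space M. \<forall>s\<in>T. a < dist (rep \<phi> \<omega>) s} \<le> a" if \<phi>: "\<phi> \<in> F" for \<phi>
  proof -
    obtain \<psi> where \<psi>: "\<psi> \<in> K" "distX \<psi> \<phi> < \<delta>" using K(3)[OF \<phi>] by blast
    define A where "A = {\<omega>\<in>space M. \<forall>s\<in>S \<psi>. a / 2 < dist (rep \<psi> \<omega>) s}"
    define B where "B = {\<omega>\<in>space M. a / 2 < \<bar>norm (rep \<psi> \<omega> - rep \<phi> \<omega>)\<bar>}"
    have A: "A \<in> C.events"
      unfolding A_def by (intro far_from_finite_event strongly_measurable_imp_borel Ksm S(1) \<psi>(1))
    have ef: "Efun (\<lambda>\<omega>. norm (rep \<psi> \<omega> - rep \<phi> \<omega>))"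
      using \<phi> \<psi> K(2) sub by (intro Efun_norm_diff) auto
    have B: "B \<in> C.events"
      unfolding B_def using borel_measurable_less[of "\<lambda>_. a / 2" "completion M" "\<lambda>\<omega>. norm (rep \<psi> \<omega> - rep \<phi> \<omega>)"]
        Efun_borel[OF ef] by simp
    have pB: "C.prob B < a / 2"
      unfolding B_def using \<psi>(2) by (intro \<delta>(2)[OF ef]) (simp add: distX_def)
    have "{\<omega>\<in>space M. \<forall>s\<in>T. a < dist (rep \<phi> \<omega>) s} \<subseteq> A \<union> B"
    proof (rule subsetI, rule ccontr)
      fix \<omega> assume \<omega>: "\<omega> \<in> {\<omega>\<in>space M. \<forall>s\<in>T. a < dist (rep \<phi> \<omega>) s}" "\<omega> \<notin> A \<union> B"
      then obtain s where s: "s \<in> S \<psi>" "dist (rep \<psi> \<omega>) s \<le> a / 2" by (auto simp: A_def not_less)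
      have "dist (rep \<psi> \<omega>) (rep \<phi> \<omega>) \<le> a / 2"
        using \<omega> by (auto simp: B_def dist_norm)
      then have "dist (rep \<phi> \<omega>) s \<le> a"
        using s(2) dist_triangle3[of "rep \<phi> \<omega>" s "rep \<psi> \<omega>"] by simp
      moreover have "a < dist (rep \<phi> \<omega>) s" using \<omega>(1) s(1) \<psi>(1) by (auto simp: T_def)
      ultimately show False by simp
    qed
    then have "C.prob {\<omega>\<in>space M. \<forall>s\<in>T. a < dist (rep \<phi> \<omega>) s} \<le> C.prob (A \<union> B)"
      using A B by (intro C.finite_measure_mono) auto
    also have "\<dots> \<le> C.prob A + C.prob B"
      using A B by (intro measure_subadditive) (auto simp: C.emeasure_eq_measure)
    also have "\<dots> \<le> a"
      using pB S(2)[OF \<psi>(1)] by (simp add: A_def)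
    finally show ?thesis .
  qed
  ultimately show ?thesis by blast
qed

lemma relatively_compact_imp_tight:
  fixes F :: "('w \<Rightarrow> 'x::banach) set set"
  assumes F: "relatively_compact_in (bfs_ext_topology M E N) F"
  shows "uniformly_tight (distribution M ` F)"
  unfolding uniformly_tight_def
proof (intro allI impI)
  fix \<epsilon> :: real assume \<epsilon>: "\<epsilon> > 0"
  have sub: "F \<subseteq> bfs_ext M E" using F unfolding relatively_compact_iff by auto
  \<comment> \<open>The same number is radius and probability bound. With \<open>Suc n\<close> the
    geometric series starts at 1/2, so the probabilities add up to exactly \<epsilon>, while the
    radii tend to 0.\<close>
  define a where "a n = \<epsilon> * (1/2)^Suc n" for n
  have a: "a n > 0" for n using \<epsilon> by (simp add: a_def)
  have sums: "a sums \<epsilon>"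
    using sums_mult[OF power_half_series, of \<epsilon>] by (simp add: a_def[abs_def])
  have "\<forall>n. \<exists>S. finite S \<and> (\<forall>\<phi>\<in>F. C.prob {\<omega>\<in>space M. \<forall>s\<in>S. a n < dist (rep \<phi> \<omega>) s} \<le> a n)"
    using relatively_compact_imp_finite_approx[OF F a] by blast
  from choice[OF this] obtain S where S: "\<And>n. finite (S n)"
    "\<And>n \<phi>. \<phi> \<in> F \<Longrightarrow> C.prob {\<omega>\<in>space M. \<forall>s\<in>S n. a n < dist (rep \<phi> \<omega>) s} \<le> a n" by blast
  \<comment> \<open>Closed, and covered by finitely many balls of arbitrarily small radius; since
    \<open>'x\<close> is complete, this makes \<open>K\<close> compact.\<close>
  define K where "K = (\<Inter>n. \<Union>s\<in>S n. cball s (a n))"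
  have "closed K"
    unfolding K_def using S(1) by (intro closed_INT closed_UN ballI) auto
  have "compact K"
    unfolding compact_eq_totally_bounded complete_eq_closed
  proof (intro conjI allI impI)
    show "closed K" by fact
    fix e :: real assume "e > 0"
    have "a \<longlonglongrightarrow> 0" using sums by (intro summable_LIMSEQ_zero) (rule sums_summable)
    then have "\<forall>\<^sub>F n in sequentially. a n < e" using \<open>e > 0\<close> by (rule order_tendstoD)
    then obtain n where n: "a n < e" by (auto simp: eventually_sequentially)
    have "K \<subseteq> (\<Union>s\<in>S n. cball s (a n))" unfolding K_def by blast
    also have "\<dots> \<subseteq> (\<Union>s\<in>S n. ball s e)" using n by auto
    finally show "\<exists>k. finite k \<and> K \<subseteq> (\<Union>x\<in>k. ball x e)" using S(1) by blast
  qed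
  moreover have "1 - \<epsilon> \<le> measure (distribution M \<phi>) K" if "\<phi> \<in> F" for \<phi>
  proof -
    have \<phi>: "\<phi> \<in> bfs_ext M E" using that sub by auto
    define A where "A n = {\<omega>\<in>space M. \<forall>s\<in>S n. a n < dist (rep \<phi> \<omega>) s}" for n
    have A: "A n \<in> C.events" for n
      unfolding A_def by (intro far_from_finite_event borel_rep \<phi> S(1))
    have le: "C.prob (A n) \<le> a n" for n
      using S(2)[OF that] by (simp add: A_def)
    have sA: "summable (\<lambda>n. C.prob (A n))"
      by (rule summable_comparison_test'[OF sums_summable[OF sums], of 0]) (use le in auto)
    have "C.prob {\<omega>\<in>space M. rep \<phi> \<omega> \<notin> K} = C.prob (\<Union>n. A n)"
      by (intro arg_cong[where f = C.prob]) (auto simp: K_def A_def dist_commute not_le)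
    also have "\<dots> \<le> (\<Sum>n. C.prob (A n))"
      using A sA by (intro C.finite_measure_subadditive_countably) auto
    also have "\<dots> \<le> (\<Sum>n. a n)"
      using le sA sums_summable[OF sums] by (intro suminf_le) auto
    also have "\<dots> = \<epsilon>" using sums by (simp add: sums_iff)
    finally show ?thesis
      using measure_distribution_compl[OF \<phi>, of K] \<open>closed K\<close> by simp
  qed
  ultimately show "\<exists>K. compact K \<and> (\<forall>\<mu>\<in>distribution M ` F. 1 - \<epsilon> \<le> measure \<mu> K)"
    by blast
qed

text \<open>The order bound is the sum of the norms over a finite net. Cutting the norm of \<phi> at
  this bound leaves a remainder of at most
  \<open>norm (rep \<psi> \<omega> - rep \<phi> \<omega>)\<close>, where \<psi> is the net element
  near \<phi>, because the norm of \<psi> is itself below the bound.\<close>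

lemma relatively_compact_imp_almost_order_bounded:
  fixes F :: "('w \<Rightarrow> 'x::banach) set set"
  assumes F: "relatively_compact_in (bfs_ext_topology M E N) F"
  shows "almost_order_bounded M E N (lift1 M norm ` F)"
  unfolding almost_order_bounded_def
proof (intro allI impI)
  have sub: "F \<subseteq> bfs_ext M E"
    and net: "\<And>e. e > 0 \<Longrightarrow> \<exists>K. finite K \<and> K \<subseteq> F \<and> (\<forall>\<phi>\<in>F. \<exists>\<psi>\<in>K. distX \<psi> \<phi> < e)"
    using F unfolding relatively_compact_iff by auto
  fix \<epsilon> :: real assume "\<epsilon> > 0"
  obtain K where K: "finite K" "K \<subseteq> F" "\<And>\<phi>. \<phi> \<in> F \<Longrightarrow> \<exists>\<psi>\<in>K. distX \<psi> \<phi> < \<epsilon>"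
    using net[OF \<open>\<epsilon> > 0\<close>] by blast
  define x where "x \<omega> = (\<Sum>\<psi>\<in>K. norm (rep \<psi> \<omega>))" for \<omega>
  have x: "Efun x" unfolding x_def using K(2) sub by (intro Efun_sum bfs_ext_rep) auto
  have x0: "0 \<le> x \<omega>" for \<omega> unfolding x_def by (intro sum_nonneg) auto
  have "\<exists>y z. lift1 M norm \<phi> = lift2 M (+) y z \<and> y \<in> E \<and> ae_le M (lift1 M uminus (ae_class M x)) y \<and>
      ae_le M y (ae_class M x) \<and> z \<in> E \<and> N z < \<epsilon>" if "\<phi> \<in> F" for \<phi>
  proof -
    obtain \<psi> where \<psi>: "\<psi> \<in> K" "distX \<psi> \<phi> < \<epsilon>" using K(3)[OF \<open>\<phi> \<in> F\<close>] by blast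
    have mem: "\<phi> \<in> bfs_ext M E" "\<psi> \<in> bfs_ext M E" using that \<psi>(1) K(2) sub by auto
    define y where "y \<omega> = min (norm (rep \<phi> \<omega>)) (x \<omega>)" for \<omega>
    define z where "z \<omega> = norm (rep \<phi> \<omega>) - y \<omega>" for \<omega>
    have b: "(\<lambda>\<omega>. norm (rep \<phi> \<omega>)) \<in> borel_measurable (completion M)" "x \<in> borel_measurable (completion M)"
      using Efun_borel x bfs_ext_rep(2)[OF mem(1)] by auto
    have ysm: "strongly_measurable M y"
      unfolding y_def using b by (simp add: strongly_measurable_real_iff)
    have y: "Efun y"
      by (rule Efun_ideal(1)[OF ysm x]) (use x0 in \<open>auto simp: y_def\<close>)
    have z: "Efun z" unfolding z_def by (intro Efun_diff bfs_ext_rep mem y)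
    have "\<bar>z \<omega>\<bar> \<le> norm (rep \<psi> \<omega> - rep \<phi> \<omega>)" for \<omega>
    proof -
      have "norm (rep \<psi> \<omega>) \<le> x \<omega>"
        unfolding x_def using K(1) \<psi>(1) by (intro member_le_sum) auto
      moreover have "norm (rep \<phi> \<omega>) \<le> norm (rep \<psi> \<omega>) + norm (rep \<psi> \<omega> - rep \<phi> \<omega>)"
        using norm_triangle_ineq4[of "rep \<psi> \<omega>" "rep \<psi> \<omega> - rep \<phi> \<omega>"] by simp
      ultimately show ?thesis by (auto simp: z_def y_def min_def)
    qed
    then have "nm z \<le> distX \<psi> \<phi>"
      unfolding distX_def by (intro Efun_ideal(2) EfunD z Efun_norm_diff mem) auto
    with \<psi>(2) have "nm z < \<epsilon>" by simp
    have "lift1 M norm \<phi> = lift2 M (+) (ae_class M y) (ae_class M z)"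
      unfolding lift2_ae_class[OF EfunD[OF y] EfunD[OF z]] lift1_def by (simp add: z_def)
    moreover have "ae_le M (ae_class M y) (ae_class M x)"
      using EfunD[OF y] EfunD[OF x] by (simp add: ae_le_ae_class y_def)
    moreover have "ae_le M (lift1 M uminus (ae_class M x)) (ae_class M y)"
    proof -
      have "strongly_measurable M (\<lambda>\<omega>. - x \<omega>)" using b(2) by (simp add: strongly_measurable_real_iff)
      moreover have "- x \<omega> \<le> y \<omega>" for \<omega>
        using x0[of \<omega>] norm_ge_zero[of "rep \<phi> \<omega>"] unfolding y_def by linarith
      ultimately show ?thesis
        using EfunD[OF y] EfunD[OF x] by (simp add: ae_le_ae_class lift1_ae_class)
    qed
    moreover have "ae_class M y \<in> E" "ae_class M z \<in> E" "N (ae_class M z) < \<epsilon>"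
      using y z \<open>nm z < \<epsilon>\<close> by (simp_all add: Efun_def nm_def)
    ultimately show ?thesis by blast
  qed
  moreover have "ae_le M (zero_L0 M) (ae_class M x)"
    unfolding zero_L0_def using EfunD[OF x] x0 by (simp add: ae_le_ae_class)
  ultimately show "\<exists>x\<in>E. ae_le M (zero_L0 M) x \<and>
        lift1 M norm ` F \<subseteq> {lift2 M (+) y z | y z. y \<in> E \<and> ae_le M (lift1 M uminus x) y \<and> ae_le M y x \<and>
                                     z \<in> E \<and> N z < \<epsilon>}"
    using x by (intro bexI[of _ "ae_class M x"] conjI subsetI) (auto simp: Efun_def)
qed

end

section \<open>Sufficiency\<close>

locale oc_prob_bfs = prob_bfs M E N for M :: "'w measure" and E N +
  assumes order_continuous: "order_continuous_norm M E N"
begin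

section \<open>Order continuity along decreasing sequences\<close>

text \<open>Index sets consist of classes, so the net is the range of the sequence under the
  reversed order, with \<open>id\<close> as the family. Convergence to 0 almost everywhere forces
  every lower bound in \<open>E\<close> below 0.\<close>

lemma decreasing_norm_tendsto_zero:
  assumes f: "\<And>n. Efun (f n)" and nonneg: "\<And>n \<omega>. 0 \<le> f n \<omega>" and dec: "\<And>m n \<omega>. m \<le> n \<Longrightarrow> f n \<omega> \<le> f m \<omega>"
    and lim: "AE \<omega> in M. (\<lambda>n. f n \<omega>) \<longlonglongrightarrow> 0" and e: "e > 0"
  shows "\<exists>n. nm (f n) < e"
proof -
  define c where "c n = ae_class M (f n)" for n
  define r where "r A B \<longleftrightarrow> ae_le M B A" for A B
  have sm: "strongly_measurable M (f n)" for n using f by (rule EfunD)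
  have c: "c n \<in> E" for n using f by (simp add: c_def Efun_def)
  have cle: "r (c m) (c n)" if "m \<le> n" for m n
    unfolding r_def c_def using dec[OF that] by (simp add: ae_le_ae_class sm)
  have "directed_preorder (range c) r"
    unfolding directed_preorder_def
  proof (intro conjI ballI impI)
    fix i j assume "i \<in> range c" "j \<in> range c"
    then obtain m n where "i = c m" "j = c n" by auto
    then have "r i (c (max m n)) \<and> r j (c (max m n))" by (auto intro: cle)
    then show "\<exists>k\<in>range c. r i k \<and> r j k" by blast
  next
    fix i j k assume "r i j" "r j k"
    then show "r i k" unfolding r_def ae_le_def by (auto elim: eventually_elim2)
  qed (auto simp: r_def ae_le_def)
  moreover have "decreases_to_zero M E (range c) r id"
    unfolding decreases_to_zero_def
  proof (intro conjI ballI impI)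
    fix i assume "i \<in> range c"
    then obtain n where i: "i = c n" by auto
    show "id i \<in> E" using c by (simp add: i)
    show "ae_le M (zero_L0 M) (id i)"
      using sm nonneg by (simp add: i c_def zero_L0_def ae_le_ae_class)
  next
    fix z assume z: "z \<in> E" "\<forall>i\<in>range c. ae_le M z (id i)"
    have zsm: "strongly_measurable M (rep z)" "ae_class M (rep z) = z"
      using rep_L0[of z M] z(1) subset_L0 by auto
    have "AE \<omega> in M. rep z \<omega> \<le> f n \<omega>" for n
      using z(2) ae_le_ae_class[OF zsm(1) sm[of n]] by (simp add: zsm(2) c_def)
    then have "AE \<omega> in M. \<forall>n. rep z \<omega> \<le> f n \<omega>" by (simp add: AE_all_countable)
    then have "AE \<omega> in M. rep z \<omega> \<le> 0"
      using lim
    proof eventually_elim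
      case (elim \<omega>)
      show ?case by (rule tendsto_lowerbound[OF elim(2)]) (use elim(1) in auto)
    qed
    then show "ae_le M z (zero_L0 M)"
      using ae_le_ae_class[OF zsm(1), of "\<lambda>_. 0"] by (simp add: zsm(2) zero_L0_def)
  qed (simp add: r_def)
  ultimately have "\<exists>i\<in>range c. \<forall>j\<in>range c. r i j \<longrightarrow> N (id j) < e"
    using order_continuous e unfolding order_continuous_norm_def by blast
  then obtain n where "\<forall>j\<in>range c. r (c n) j \<longrightarrow> N j < e" by auto
  then have "N (c n) < e" using cle[of n n] by blast
  then show ?thesis by (auto simp: nm_def c_def)
qed

text \<open>The truncations at height 1/(n+1) decrease to 0 everywhere and are dominated by
  \<open>x\<close>; \<eta> is one of these heights.\<close>

lemma small_truncation:
  assumes x: "Efun x" "\<And>\<omega>. 0 \<le> x \<omega>" and e: "e > 0"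
  shows "\<exists>\<eta>>0. Efun (\<lambda>\<omega>. min \<eta> (x \<omega>)) \<and> nm (\<lambda>\<omega>. min \<eta> (x \<omega>)) < e"
proof -
  define f where "f n \<omega> = min (inverse (real (Suc n))) (x \<omega>)" for n \<omega>
  have f: "Efun (f n)" for n
  proof (rule Efun_ideal(1)[OF _ x(1)])
    show "strongly_measurable M (f n)"
      unfolding f_def using Efun_borel[OF x(1)] by (simp add: strongly_measurable_real_iff)
  qed (use x(2) in \<open>auto simp: f_def\<close>)
  have "\<exists>n. nm (f n) < e"
  proof (rule decreasing_norm_tendsto_zero[OF f _ _ _ e])
    show "0 \<le> f n \<omega>" for n \<omega> using x(2) by (auto simp: f_def)
    show "f n \<omega> \<le> f m \<omega>" if "m \<le> n" for m n \<omega>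
      unfolding f_def using that by (intro min.mono) (auto simp: field_simps)
    have "(\<lambda>n. f n \<omega>) \<longlonglongrightarrow> 0" for \<omega>
    proof (rule tendsto_sandwich[OF _ _ tendsto_const LIMSEQ_inverse_real_of_nat])
      show "\<forall>\<^sub>F n in sequentially. 0 \<le> f n \<omega>" using x(2) by (auto simp: f_def)
    qed (auto simp: f_def)
    then show "AE \<omega> in M. (\<lambda>n. f n \<omega>) \<longlonglongrightarrow> 0" by simp
  qed
  then obtain n where "nm (f n) < e" ..
  then show ?thesis
    using f[of n] by (intro exI[of _ "inverse (real (Suc n))"]) (simp add: f_def[abs_def])
qed

lemma Efun_indicator:
  assumes x: "Efun x" and A: "A \<in> C.events"
  shows "Efun (\<lambda>\<omega>. indicator A \<omega> * x \<omega>)"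
proof (rule Efun_ideal(1)[OF _ x])
  show "strongly_measurable M (\<lambda>\<omega>. indicator A \<omega> * x \<omega>)"
    using Efun_borel[OF x] A by (simp add: strongly_measurable_real_iff)
qed (auto simp: indicator_def)

text \<open>Absolute continuity of the norm at \<open>x\<close>. Bad sets of probability below 2^-n
  have, by Borel--Cantelli, tail unions decreasing to a null set, so \<open>x\<close> restricted to
  these unions falls to 0 in norm.\<close>

lemma small_on_small_sets:
  assumes x: "Efun x" "\<And>\<omega>. 0 \<le> x \<omega>" and e: "e > 0"
  shows "\<exists>\<delta>>0. \<forall>A\<in>C.events. C.prob A < \<delta> \<longrightarrow> nm (\<lambda>\<omega>. indicator A \<omega> * x \<omega>) < e"
proof (rule ccontr)
  assume "\<not> ?thesis"
  then have neg: "\<exists>A. A \<in> C.events \<and> C.prob A < \<delta> \<and> \<not> nm (\<lambda>\<omega>. indicator A \<omega> * x \<omega>) < e"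
    if "\<delta> > 0" for \<delta> using that by blast
  have "\<forall>n. \<exists>A. A \<in> C.events \<and> C.prob A < (1/2)^n \<and> \<not> nm (\<lambda>\<omega>. indicator A \<omega> * x \<omega>) < e"
    by (intro allI neg) simp
  from choice[OF this] obtain A where A: "\<And>n. A n \<in> C.events" "\<And>n. C.prob (A n) < (1/2)^n"
    "\<And>n. \<not> nm (\<lambda>\<omega>. indicator (A n) \<omega> * x \<omega>) < e" by blast
  have "summable (\<lambda>n. C.prob (A n))"
    by (rule summable_comparison_test'[of "\<lambda>n. (1/2)^n" 0]) (use less_imp_le[OF A(2)] in auto)
  then have "AE \<omega> in completion M. \<forall>\<^sub>F n in sequentially. \<omega> \<in> space (completion M) - A n"
    using A(1) by (intro borel_cantelli_AE1) (auto simp: C.emeasure_eq_measure)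
  then have bc: "AE \<omega> in M. \<forall>\<^sub>F n in sequentially. \<omega> \<notin> A n"
    unfolding AE_completion_iff by eventually_elim (auto elim: eventually_mono)
  \<comment> \<open>The sets \<open>A n\<close> need not be nested; their tail unions are, and they
    contain them.\<close>
  define B where "B n = (\<Union>m\<in>{n..}. A m)" for n
  have B: "B n \<in> C.events" for n
    unfolding B_def using A(1) by auto
  have "\<exists>n. nm (\<lambda>\<omega>. indicator (B n) \<omega> * x \<omega>) < e"
  proof (rule decreasing_norm_tendsto_zero[OF _ _ _ _ e])
    show "Efun (\<lambda>\<omega>. indicator (B n) \<omega> * x \<omega>)" for n by (rule Efun_indicator[OF x(1) B])
    show "0 \<le> indicator (B n) \<omega> * x \<omega>" for n \<omega> using x(2) by simp
    show "indicator (B n) \<omega> * x \<omega> \<le> indicator (B m) \<omega> * x \<omega>" if "m \<le> n" for m n \<omega>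
      using that x(2) by (force simp: B_def indicator_def)
    show "AE \<omega> in M. (\<lambda>n. indicator (B n) \<omega> * x \<omega>) \<longlonglongrightarrow> 0"
      using bc
    proof eventually_elim
      case (elim \<omega>)
      then obtain k where "\<And>n. n \<ge> k \<Longrightarrow> \<omega> \<notin> A n" by (auto simp: eventually_sequentially)
      then have "\<forall>\<^sub>F n in sequentially. indicator (B n) \<omega> * x \<omega> = 0"
        unfolding eventually_sequentially by (intro exI[of _ k]) (auto simp: B_def indicator_def)
      then show ?case by (rule tendsto_eventually)
    qed
  qed
  then obtain n where "nm (\<lambda>\<omega>. indicator (B n) \<omega> * x \<omega>) < e" ..
  moreover have "nm (\<lambda>\<omega>. indicator (A n) \<omega> * x \<omega>) \<le> nm (\<lambda>\<omega>. indicator (B n) \<omega> * x \<omega>)"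
    by (intro Efun_ideal(2) EfunD Efun_indicator x(1) A(1) B)
      (auto simp: B_def indicator_def)
  ultimately show False using A(3)[of n] by simp
qed

text \<open>Absolute values of the representatives make bound and remainder nonnegative everywhere
  rather than almost everywhere, with no change of the norm of the remainder.\<close>

lemma almost_order_boundedD:
  fixes F :: "('w \<Rightarrow> 'x::real_normed_vector) set set"
  assumes F: "F \<subseteq> bfs_ext M E" and aob: "almost_order_bounded M E N (lift1 M norm ` F)" and e: "e > 0"
  obtains x where "Efun x" "\<And>\<omega>. 0 \<le> x \<omega>"
    "\<And>\<phi>. \<phi> \<in> F \<Longrightarrow> \<exists>z. Efun z \<and> nm z < e \<and> (\<forall>\<omega>. 0 \<le> z \<omega>) \<and> (AE \<omega> in M. norm (rep \<phi> \<omega>) \<le> x \<omega> + z \<omega>)"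
proof -
  obtain x where x: "x \<in> E" and dec: "lift1 M norm ` F \<subseteq> {lift2 M (+) y z | y z. y \<in> E \<and>
      ae_le M (lift1 M uminus x) y \<and> ae_le M y x \<and> z \<in> E \<and> N z < e}"
    using aob e unfolding almost_order_bounded_def by blast
  show thesis
  proof (rule that)
    show "Efun (\<lambda>\<omega>. \<bar>rep x \<omega>\<bar>)" by (intro Efun_abs Efun_rep x)
    fix \<phi> assume \<phi>: "\<phi> \<in> F"
    then have "lift1 M norm \<phi> \<in> lift1 M norm ` F" by blast
    with dec obtain y z where yz: "lift1 M norm \<phi> = lift2 M (+) y z" "ae_le M y x" "z \<in> E" "N z < e"
      by blast
    have "strongly_measurable M (\<lambda>\<omega>. norm (rep \<phi> \<omega>))"
      using \<phi> F by (intro strongly_measurable_norm bfs_ext_rep) auto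
    then have "AE \<omega> in M. norm (rep \<phi> \<omega>) = rep y \<omega> + rep z \<omega>"
      using yz(1) unfolding lift1_def lift2_def by (rule ae_class_eqD[rotated])
    moreover have "AE \<omega> in M. rep y \<omega> \<le> rep x \<omega>" using yz(2) by (simp add: ae_le_def)
    ultimately have "AE \<omega> in M. norm (rep \<phi> \<omega>) \<le> \<bar>rep x \<omega>\<bar> + \<bar>rep z \<omega>\<bar>"
      by eventually_elim linarith
    then show "\<exists>z. Efun z \<and> nm z < e \<and> (\<forall>\<omega>. 0 \<le> z \<omega>) \<and> (AE \<omega> in M. norm (rep \<phi> \<omega>) \<le> \<bar>rep x \<omega>\<bar> + z \<omega>)"
      using Efun_abs[OF Efun_rep(1)[OF yz(3)]] Efun_rep(2)[OF yz(3)] yz(4)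
      by (intro exI[of _ "\<lambda>\<omega>. \<bar>rep z \<omega>\<bar>"]) auto
  qed auto
qed

lemma real_dualD: "f \<in> real_dual \<Longrightarrow> bounded_linear f"
  by (simp add: real_dual_def)

section \<open>Reduction to finitely many scalar distances\<close>

lemma finitely_many_functionals_control_distance:
  fixes F :: "('w \<Rightarrow> 'x::banach) set set"
  assumes F: "F \<subseteq> bfs_ext M E" and tight: "uniformly_tight (distribution M ` F)"
    and aob: "almost_order_bounded M E N (lift1 M norm ` F)" and e: "e > 0"
  obtains \<Phi> where "finite \<Phi>" "\<Phi> \<subseteq> real_dual"
    "\<And>\<phi> \<psi>. \<phi> \<in> F \<Longrightarrow> \<psi> \<in> F \<Longrightarrow> distX \<phi> \<psi> \<le> (\<Sum>f\<in>\<Phi>. distX (lift1 M f \<phi>) (lift1 M f \<psi>)) + e"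
proof -
  \<comment> \<open>Six units: the truncation and the restriction of \<open>x\<close> to
    \<open>D\<close> each count twice, since both \<phi> and \<psi> are bounded through
    \<open>x\<close>; the two remainders count once each.\<close>
  have e6: "e / 6 > 0" using e by simp
  obtain x where x: "Efun x" "\<And>\<omega>. 0 \<le> x \<omega>"
    and bound: "\<And>\<phi>. \<phi> \<in> F \<Longrightarrow> \<exists>z. Efun z \<and> nm z < e / 6 \<and> (\<forall>\<omega>. 0 \<le> z \<omega>) \<and>
      (AE \<omega> in M. norm (rep \<phi> \<omega>) \<le> x \<omega> + z \<omega>)"
    by (rule almost_order_boundedD[OF F aob e6]) blast
  obtain \<delta> where \<delta>: "\<delta> > 0" "\<And>A. A \<in> C.events \<Longrightarrow> C.prob A < \<delta> \<Longrightarrow> nm (\<lambda>\<omega>. indicator A \<omega> * x \<omega>) < e / 6"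
    using small_on_small_sets[OF x e6] by blast
  obtain \<eta> where \<eta>: "\<eta> > 0" "Efun (\<lambda>\<omega>. min \<eta> (x \<omega>))" "nm (\<lambda>\<omega>. min \<eta> (x \<omega>)) < e / 6"
    using small_truncation[OF x e6] by blast
  \<comment> \<open>Two exceptional sets of measure at most \<delta>/3 have a union of measure
    strictly below \<delta>.\<close>
  have "\<delta> / 3 > 0" using \<delta>(1) by simp
  with tight have "\<exists>K. compact K \<and> (\<forall>\<mu>\<in>distribution M ` F. 1 - \<delta> / 3 \<le> measure \<mu> K)"
    by (simp only: uniformly_tight_def)
  then obtain K where K: "compact K" "\<And>\<phi>. \<phi> \<in> F \<Longrightarrow> 1 - \<delta> / 3 \<le> measure (distribution M \<phi>) K"
    by auto
  obtain \<Phi> where \<Phi>: "finite \<Phi>" "\<Phi> \<subseteq> real_dual"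
    "\<And>u v. u \<in> K \<Longrightarrow> v \<in> K \<Longrightarrow> norm (u - v) \<le> (\<Sum>f\<in>\<Phi>. \<bar>f (u - v)\<bar>) + \<eta>"
    by (rule compact_norming_functionals[OF K(1) \<eta>(1)]) blast
  show thesis
  proof (rule that[OF \<Phi>(1,2)])
    fix \<phi> \<psi> assume \<phi>: "\<phi> \<in> F" and \<psi>: "\<psi> \<in> F"
    have mem: "\<phi> \<in> bfs_ext M E" "\<psi> \<in> bfs_ext M E" using \<phi> \<psi> F by auto
    define A where "A \<theta> = {\<omega>\<in>space M. rep \<theta> \<omega> \<notin> K}" for \<theta>
    have A: "A \<theta> \<in> C.events" "C.prob (A \<theta>) \<le> \<delta> / 3" if "\<theta> \<in> F" for \<theta>
    proof -
      have m: "\<theta> \<in> bfs_ext M E" using that F by auto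
      have Kb: "K \<in> sets borel" using K(1) by (intro borel_closed compact_imp_closed)
      have "A \<theta> = space (completion M) - rep \<theta> -` K \<inter> space (completion M)" by (auto simp: A_def)
      then show "A \<theta> \<in> C.events"
        using sets.Diff[OF sets.top measurable_sets[OF borel_rep[OF m] Kb]] by (simp only:)
      show "C.prob (A \<theta>) \<le> \<delta> / 3"
        using K(2)[OF that] measure_distribution_compl[OF m Kb] by (simp add: A_def)
    qed
    define D where "D = A \<phi> \<union> A \<psi>"
    have D: "D \<in> C.events" using A(1) \<phi> \<psi> by (simp add: D_def)
    have "C.prob D \<le> C.prob (A \<phi>) + C.prob (A \<psi>)"
      unfolding D_def using A(1) \<phi> \<psi> by (intro measure_subadditive) (auto simp: C.emeasure_eq_measure)
    then have "C.prob D < \<delta>" using A(2)[OF \<phi>] A(2)[OF \<psi>] \<delta>(1) by simp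
    then have nD: "nm (\<lambda>\<omega>. indicator D \<omega> * x \<omega>) < e / 6" using \<delta>(2) D by blast
    have eD: "Efun (\<lambda>\<omega>. indicator D \<omega> * x \<omega>)" by (rule Efun_indicator[OF x(1) D])
    obtain y where y: "Efun y" "nm y < e / 6" "\<And>\<omega>. 0 \<le> y \<omega>" "AE \<omega> in M. norm (rep \<phi> \<omega>) \<le> x \<omega> + y \<omega>"
      using bound[OF \<phi>] by blast
    obtain z where z: "Efun z" "nm z < e / 6" "\<And>\<omega>. 0 \<le> z \<omega>" "AE \<omega> in M. norm (rep \<psi> \<omega>) \<le> x \<omega> + z \<omega>"
      using bound[OF \<psi>] by blast
    define s where "s \<omega> = (\<Sum>f\<in>\<Phi>. norm (f (rep \<phi> \<omega> - rep \<psi> \<omega>)))" for \<omega>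
    have fE: "Efun (\<lambda>\<omega>. norm (f (rep \<phi> \<omega> - rep \<psi> \<omega>)))" if "f \<in> \<Phi>" for f
      using that \<Phi>(2) by (intro Efun_norm_diff_image mem real_dualD) auto
    have s: "Efun s" unfolding s_def by (intro Efun_sum fE)
    have s0: "0 \<le> s \<omega>" for \<omega> unfolding s_def by (intro sum_nonneg) auto
    have ns: "nm s \<le> (\<Sum>f\<in>\<Phi>. distX (lift1 M f \<phi>) (lift1 M f \<psi>))"
    proof -
      have "nm s \<le> (\<Sum>f\<in>\<Phi>. nm (\<lambda>\<omega>. norm (f (rep \<phi> \<omega> - rep \<psi> \<omega>))))"
        unfolding s_def by (intro nm_sum fE)
      also have "\<dots> = (\<Sum>f\<in>\<Phi>. distX (lift1 M f \<phi>) (lift1 M f \<psi>))"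
        using \<Phi>(2) by (intro sum.cong refl distX_lift1[symmetric] mem real_dualD) auto
      finally show ?thesis .
    qed
    define w where "w \<omega> = min \<eta> (x \<omega>) + indicator D \<omega> * x \<omega>" for \<omega>
    have w: "Efun w" unfolding w_def by (intro Efun_add \<eta> eD)
    have nw: "nm w \<le> 2 * (e / 6)"
      unfolding w_def using nm_add[OF \<eta>(2) eD] \<eta>(3) nD by simp
    have "AE \<omega> in M. \<bar>norm (rep \<phi> \<omega> - rep \<psi> \<omega>)\<bar> \<le> \<bar>s \<omega> + (2 * w \<omega> + (y \<omega> + z \<omega>))\<bar>"
      using y(4) z(4) AE_space
    proof eventually_elim
      case (elim \<omega>)
      have n: "norm (rep \<phi> \<omega> - rep \<psi> \<omega>) \<le> 2 * x \<omega> + y \<omega> + z \<omega>"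
        using norm_triangle_ineq4[of "rep \<phi> \<omega>" "rep \<psi> \<omega>"] elim(1,2) by simp
      have m0: "0 \<le> min \<eta> (x \<omega>)" using \<eta>(1) x(2)[of \<omega>] by simp
      have "norm (rep \<phi> \<omega> - rep \<psi> \<omega>) \<le> s \<omega> + (2 * w \<omega> + (y \<omega> + z \<omega>))"
      proof (cases "\<omega> \<in> D")
        case True
        then have "w \<omega> = min \<eta> (x \<omega>) + x \<omega>" by (simp add: w_def)
        then show ?thesis using n m0 s0[of \<omega>] by linarith
      next
        case False
        then have "rep \<phi> \<omega> \<in> K" "rep \<psi> \<omega> \<in> K" using elim(3) by (auto simp: D_def A_def)
        then have "norm (rep \<phi> \<omega> - rep \<psi> \<omega>) \<le> s \<omega> + \<eta>" using \<Phi>(3) by (simp add: s_def)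
        \<comment> \<open>If \<open>\<eta> \<le> x \<omega>\<close>, then
          \<open>w \<omega> = \<eta>\<close> and the estimate on \<open>K\<close> suffices;
          otherwise \<open>w \<omega> = x \<omega>\<close> and the crude bound \<open>n\<close>
          does.\<close>
        then show ?thesis
          using False n s0[of \<omega>] y(3)[of \<omega>] z(3)[of \<omega>] \<eta>(1) by (auto simp: w_def min_def)
      qed
      then show ?case by simp
    qed
    then have "distX \<phi> \<psi> \<le> nm (\<lambda>\<omega>. s \<omega> + (2 * w \<omega> + (y \<omega> + z \<omega>)))"
      unfolding distX_def by (intro Efun_ideal(2) EfunD[OF Efun_norm_diff] mem Efun_add Efun_scale s w y z)
    also have "\<dots> \<le> nm s + (2 * nm w + (nm y + nm z))"
      using nm_add[OF s Efun_add[OF Efun_scale[OF w, of 2] Efun_add[OF y(1) z(1)]]]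
        nm_add[OF Efun_scale[OF w, of 2] Efun_add[OF y(1) z(1)]] nm_add[OF y(1) z(1)] nm_scale[OF w, of 2]
      by simp
    also have "\<dots> \<le> (\<Sum>f\<in>\<Phi>. distX (lift1 M f \<phi>) (lift1 M f \<psi>)) + e"
      using ns nw y(2) z(2) by simp
    finally show "distX \<phi> \<psi> \<le> (\<Sum>f\<in>\<Phi>. distX (lift1 M f \<phi>) (lift1 M f \<psi>)) + e" .
  qed
qed

text \<open>A pigeonhole argument: each element of \<open>F\<close> is coded by a tuple of nearby
  net elements, one per functional. Only finitely many codes occur, and elements with equal codes
  are close under every functional.\<close>

lemma relatively_compactI:
  fixes F :: "('w \<Rightarrow> 'x::banach) set set"
  assumes F: "F \<subseteq> bfs_ext M E" and tight: "uniformly_tight (distribution M ` F)"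
    and aob: "almost_order_bounded M E N (lift1 M norm ` F)"
    and scalar: "scalarly_relatively_compact M E N real_dual F"
  shows "relatively_compact_in (bfs_ext_topology M E N) F"
  unfolding relatively_compact_iff
proof (intro conjI allI impI)
  fix e :: real assume e: "e > 0"
  then have e2: "e / 2 > 0" by simp
  obtain \<Phi> where \<Phi>: "finite \<Phi>" "\<Phi> \<subseteq> real_dual"
    "\<And>\<phi> \<psi>. \<phi> \<in> F \<Longrightarrow> \<psi> \<in> F \<Longrightarrow> distX \<phi> \<psi> \<le> (\<Sum>f\<in>\<Phi>. distX (lift1 M f \<phi>) (lift1 M f \<psi>)) + e / 2"
    by (rule finitely_many_functionals_control_distance[OF F tight aob e2]) blast
  \<comment> \<open>Equal codes give scalar distances up to 2d, in total
    \<open>2 * card \<Phi> * d\<close>, which is strictly below e/2; the summand 4 also covers empty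
    \<Phi>.\<close>
  define d where "d = e / (4 * real (card \<Phi>) + 4)"
  have d: "d > 0" using e by (simp add: d_def)
  have "\<forall>f\<in>\<Phi>. \<exists>K. finite K \<and> K \<subseteq> lift1 M f ` F \<and> (\<forall>\<phi>\<in>lift1 M f ` F. \<exists>\<psi>\<in>K. distX \<psi> \<phi> < d)"
  proof
    fix f assume "f \<in> \<Phi>"
    then have "relatively_compact_in (bfs_ext_topology M E N) (lift1 M f ` F)"
      using scalar \<Phi>(2) by (auto simp: scalarly_relatively_compact_def)
    then show "\<exists>K. finite K \<and> K \<subseteq> lift1 M f ` F \<and> (\<forall>\<phi>\<in>lift1 M f ` F. \<exists>\<psi>\<in>K. distX \<psi> \<phi> < d)"
      unfolding relatively_compact_iff using d by auto
  qed
  from bchoice[OF this] obtain K where K0: "\<forall>f\<in>\<Phi>. finite (K f) \<and> K f \<subseteq> lift1 M f ` F \<and>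
      (\<forall>\<phi>\<in>lift1 M f ` F. \<exists>\<psi>\<in>K f. distX \<psi> \<phi> < d)" ..
  have K: "finite (K f)" "K f \<subseteq> lift1 M f ` F" "\<And>\<phi>. \<phi> \<in> F \<Longrightarrow> \<exists>\<psi>\<in>K f. distX \<psi> (lift1 M f \<phi>) < d"
    if "f \<in> \<Phi>" for f
    using bspec[OF K0 that] by auto
  \<comment> \<open>Restriction to \<Phi> makes the codes extensional, so that they lie in a finite
    dependent product.\<close>
  define c where "c \<phi> = (\<lambda>f\<in>\<Phi>. SOME \<psi>. \<psi> \<in> K f \<and> distX \<psi> (lift1 M f \<phi>) < d)" for \<phi>
  have c: "c \<phi> f \<in> K f" "distX (c \<phi> f) (lift1 M f \<phi>) < d" if "f \<in> \<Phi>" "\<phi> \<in> F" for f \<phi>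
  proof -
    have "\<exists>\<psi>. \<psi> \<in> K f \<and> distX \<psi> (lift1 M f \<phi>) < d" using K(3)[OF that] by blast
    from someI_ex[OF this] show "c \<phi> f \<in> K f" "distX (c \<phi> f) (lift1 M f \<phi>) < d"
      using that(1) by (auto simp: c_def)
  qed
  have "c ` F \<subseteq> (\<Pi>\<^sub>E f\<in>\<Phi>. K f)"
    using c(1) by (auto simp: c_def restrict_def)
  moreover have "finite (\<Pi>\<^sub>E f\<in>\<Phi>. K f)" using \<Phi>(1) K(1) by (intro finite_PiE)
  ultimately have fin: "finite (c ` F)" by (rule finite_subset)
  \<comment> \<open>One element of \<open>F\<close> for every code that occurs.\<close>
  define G where "G = inv_into F c ` c ` F"
  have "finite G" using fin by (simp add: G_def)
  moreover have "G \<subseteq> F" unfolding G_def by (auto intro: inv_into_into)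
  moreover have "\<exists>\<psi>\<in>G. distX \<psi> \<phi> < e" if \<phi>: "\<phi> \<in> F" for \<phi>
  proof
    let ?\<psi> = "inv_into F c (c \<phi>)"
    show "?\<psi> \<in> G" using \<phi> by (auto simp: G_def)
    have \<psi>: "?\<psi> \<in> F" "c ?\<psi> = c \<phi>" using \<phi> by (auto intro: inv_into_into f_inv_into_f)
    have "distX (lift1 M f ?\<psi>) (lift1 M f \<phi>) \<le> 2 * d" if f: "f \<in> \<Phi>" for f
    proof -
      have mem: "lift1 M f \<theta> \<in> bfs_ext M E" if "\<theta> \<in> F" for \<theta>
        using that F f \<Phi>(2) by (intro lift1_ext real_dualD) auto
      have "c \<phi> f \<in> bfs_ext M E" using c(1)[OF f \<phi>] K(2)[OF f] mem by auto
      then have "distX (lift1 M f ?\<psi>) (lift1 M f \<phi>) \<le> distX (lift1 M f ?\<psi>) (c \<phi> f) + distX (c \<phi> f) (lift1 M f \<phi>)"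
        by (intro distX_triangle mem \<psi>(1) \<phi>)
      also have "\<dots> \<le> 2 * d"
        using c(2)[OF f \<psi>(1)] c(2)[OF f \<phi>] \<psi>(2) by (simp add: distX_commute[of "lift1 M f ?\<psi>"])
      finally show ?thesis .
    qed
    then have "(\<Sum>f\<in>\<Phi>. distX (lift1 M f ?\<psi>) (lift1 M f \<phi>)) \<le> real (card \<Phi>) * (2 * d)"
      by (rule sum_bounded_above)
    also have "\<dots> < e / 2"
      using e by (simp add: d_def field_simps)
    finally show "distX ?\<psi> \<phi> < e"
      using \<Phi>(3)[OF \<psi>(1) \<phi>] by simp
  qed
  ultimately show "\<exists>K. finite K \<and> K \<subseteq> F \<and> (\<forall>\<phi>\<in>F. \<exists>\<psi>\<in>K. distX \<psi> \<phi> < e)" by blast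
qed (rule F)

section \<open>Real and complex functionals\<close>

lemma relatively_compact_imp_scalarly:
  fixes F :: "('w \<Rightarrow> 'x::banach) set set" and D :: "('x \<Rightarrow> 'k::{real_normed_field,banach}) set"
  assumes "relatively_compact_in (bfs_ext_topology M E N) F" "\<And>f. f \<in> D \<Longrightarrow> bounded_linear f"
  shows "scalarly_relatively_compact M E N D F"
  using assms by (auto simp: scalarly_relatively_compact_def intro: relatively_compact_lift1)

text \<open>A real functional \<open>f\<close> is the real part of the complex-linear functional
  \<open>f x - \<i> * f (sc \<i> x)\<close>; taking real parts is bounded linear and therefore
  preserves relative compactness.\<close>

lemma complex_scalarly_imp_real_scalarly:
  fixes F :: "('w \<Rightarrow> 'x::banach) set set" and sc :: "complex \<Rightarrow> 'x \<Rightarrow> 'x"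
  assumes F: "F \<subseteq> bfs_ext M E" and sc: "complex_normed_space sc"
    and scalar: "scalarly_relatively_compact M E N (complex_dual sc) F"
  shows "scalarly_relatively_compact M E N real_dual F"
  unfolding scalarly_relatively_compact_def
proof
  interpret V: vector_space sc using sc by (simp add: complex_normed_space_def)
  have scR: "sc (of_real r) x = r *\<^sub>R x" and scN: "norm (sc a x) = cmod a * norm x" for r a x
    using sc by (auto simp: complex_normed_space_def)
  fix f :: "'x \<Rightarrow> real" assume "f \<in> real_dual"
  then have f: "bounded_linear f" by (simp add: real_dual_def)
  interpret f: bounded_linear f by (rule f)
  \<comment> \<open>\<open>f\<close> respects real scalars only, so complex multiplication is broken
    into real multiples of x and of ix.\<close>
  have sci: "sc a x = Re a *\<^sub>R x + Im a *\<^sub>R sc \<i> x" for a x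
  proof -
    have "sc (of_real (Re a) + of_real (Im a) * \<i>) x = Re a *\<^sub>R x + Im a *\<^sub>R sc \<i> x"
      unfolding V.scale_left_distrib V.scale_scale[symmetric] scR ..
    then show ?thesis by (simp add: complex_eq[symmetric] mult.commute)
  qed
  have scii: "sc \<i> (sc \<i> x) = - x" for x
    using scR[of "-1" x] by simp
  define g where "g x = Complex (f x) (- f (sc \<i> x))" for x
  have bl: "bounded_linear (\<lambda>x. sc \<i> x)"
    by (rule bounded_linear_intro[where K = 1])
      (simp_all add: V.scale_right_distrib scN scR[symmetric] V.scale_scale mult.commute)
  have "g = (\<lambda>x. of_real (f x) + \<i> * of_real (- f (sc \<i> x)))"
    by (simp add: g_def complex_eq_iff fun_eq_iff)
  moreover have "bounded_linear (\<lambda>x. complex_of_real (f x) + \<i> * complex_of_real (- f (sc \<i> x)))"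
    by (intro bounded_linear_add bounded_linear_const_mult bounded_linear_compose[OF bounded_linear_of_real]
        bounded_linear_minus bounded_linear_compose[OF f bl] f)
  ultimately have gbl: "bounded_linear g" by simp
  have "g (sc a x) = a * g x" for a x
  proof -
    have 1: "f (sc a x) = Re a * f x + Im a * f (sc \<i> x)"
      unfolding sci[of a x] by (simp add: f.add f.scaleR)
    have "sc \<i> (sc a x) = sc a (sc \<i> x)" by (simp add: mult.commute)
    then have 2: "f (sc \<i> (sc a x)) = Re a * f (sc \<i> x) - Im a * f x"
      using sci[of a "sc \<i> x"] by (simp add: scii f.add f.diff f.scaleR mult.commute)
    show ?thesis unfolding g_def 1 2 by (simp add: complex_eq_iff)
  qed
  with gbl have g: "g \<in> complex_dual sc" by (simp add: complex_dual_def)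
  then have "relatively_compact_in (bfs_ext_topology M E N) (lift1 M g ` F)"
    using scalar by (simp add: scalarly_relatively_compact_def)
  then have "relatively_compact_in (bfs_ext_topology M E N) (lift1 M Re ` lift1 M g ` F)"
    by (rule relatively_compact_lift1[OF bounded_linear_Re])
  moreover have "lift1 M Re ` lift1 M g ` F = lift1 M f ` F"
    unfolding image_image using F by (intro image_cong refl) (subst lift1_lift1[OF gbl], auto simp: g_def)
  ultimately show "relatively_compact_in (bfs_ext_topology M E N) (lift1 M f ` F)" by simp
qed

end

text \<open>Only the dual depends on the scalar field, so the complex case is a second equivalence
  for the same \<open>F\<close>, for every compatible complex multiplication on
  \<open>'x\<close>.\<close>

theorem theorem5:
  fixes M :: "'w measure"
    and E :: "('w \<Rightarrow> real) set set"
    and N :: "('w \<Rightarrow> real) set \<Rightarrow> real"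
    and F :: "('w \<Rightarrow> 'x::banach) set set"
  assumes "prob_space M"
    and "banach_function_space M E N"
    and "order_continuous_norm M E N"
    and "F \<subseteq> bfs_ext M E"
  shows "(relatively_compact_in (bfs_ext_topology M E N) F \<longleftrightarrow>
            uniformly_tight (distribution M ` F) \<and>
            almost_order_bounded M E N (lift1 M norm ` F) \<and>
            scalarly_relatively_compact M E N real_dual F) \<and>
         (\<forall>sc :: complex \<Rightarrow> 'x \<Rightarrow> 'x. complex_normed_space sc \<longrightarrow>
           (relatively_compact_in (bfs_ext_topology M E N) F \<longleftrightarrow>
            uniformly_tight (distribution M ` F) \<and>
            almost_order_bounded M E N (lift1 M norm ` F) \<and>
            scalarly_relatively_compact M E N (complex_dual sc) F))"
proof -
  interpret oc_prob_bfs M E N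
    by (rule oc_prob_bfs.intro[OF prob_bfs.intro[OF assms(1,2)] oc_prob_bfs_axioms.intro[OF assms(3)]])
  let ?rc = "relatively_compact_in (bfs_ext_topology M E N) F"
  have "scalarly_relatively_compact M E N real_dual F" if ?rc
    using that by (rule relatively_compact_imp_scalarly) (simp add: real_dual_def)
  moreover have "scalarly_relatively_compact M E N (complex_dual sc) F" if ?rc for sc
    using that by (rule relatively_compact_imp_scalarly) (simp add: complex_dual_def)
  ultimately show ?thesis
    using relatively_compactI[OF assms(4)] complex_scalarly_imp_real_scalarly[OF assms(4)]
      relatively_compact_imp_tight[of F] relatively_compact_imp_almost_order_bounded[of F]
    by blast
qed

end
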